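(* Let $U\in\mathrm{U}(2)$. There is a real number $\theta$, depending only on $U$, such that the following holds. Let $0<\epsilon\le 2$ and let $n_b$ be a fixed positive integer (the base number of control qubits) satisfying $$n_b\ \ge\ \log_2\left(\frac{|\theta|}{\arccos\left(1-\epsilon^2/2\right)}\right).$$ Then for every integer $n\ge n_b+5$, the $n$-controlled gate $C^nU$ can be implemented approximately, up to an error $\epsilon$, by a quantum circuit without ancilla qubits (acting only on the $n$ control qubits and the target qubit) that consists of single-qubit gates and at most $$4(n_b-1)^2+24n-8n_b-20$$ CNOT gates and has depth $\mathcal{O}(\log n)$ (as $n\to\infty$ with $U$, $\epsilon$ and $n_b$ fixed).
   Context: Circuits are built from arbitrary single-qubit unitary gates and CNOT gates (between arbitrary pairs of qubits). The CNOT count is the number of CNOT gates used. The depth is the minimal number of layers into which the gates can be arranged so that gates in the same layer act on disjoint qubits. The gate $C^nU$ has $n$ control qubits and one target qubit: it applies $U$ to the target if all $n$ controls are in state $|1\rangle$, and acts as the identity on the target when some control is in the computational basis state $|0\rangle$. A circuit with unitary $V$ on the $n+1$ qubits implements $C^nU$ up to an error $\epsilon$ if $\|V-C^nU\|\le\epsilon$ in the operator (spectral) norm. The convention $\log_2 0=-\infty$ is used. *)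

theory Defs
  imports
    Complex_Main
    "HOL-Library.Landau_Symbols"
    "HOL-Analysis.L2_Norm"
    "Jordan_Normal_Form.Schur_Decomposition"
begin

text \<open>
  Operators on \<open>N\<close> qubits, numbered \<open>0, \<dots>, N - 1\<close>, are complex \<open>2 ^ N \<times> 2 ^ N\<close> matrices.
  The computational basis is indexed by the numbers below \<open>2 ^ N\<close>: in the basis state with
  index \<open>i\<close>, qubit \<open>q\<close> is in state \<open>|1\<rangle>\<close> iff binary digit \<open>q\<close> of \<open>i\<close> is set (qubit \<open>0\<close> is the
  least significant digit).
\<close>

definition unitary_mat :: "nat \<Rightarrow> complex mat \<Rightarrow> bool" where
  "unitary_mat d U \<longleftrightarrow> U \<in> carrier_mat d d \<and> mat_adjoint U * U = 1\<^sub>m d"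

definition euclid_norm :: "complex vec \<Rightarrow> real" where
  "euclid_norm v = L2_set (\<lambda>i. cmod (v $ i)) {..<dim_vec v}"

definition spectral_norm :: "complex mat \<Rightarrow> real" where
  "spectral_norm A =
     (SUP v \<in> {v \<in> carrier_vec (dim_col A). euclid_norm v = 1}. euclid_norm (A *\<^sub>v v))"

text \<open>
  The operator on \<open>N\<close> qubits that applies \<open>U\<close> to qubit \<open>t\<close> if all qubits in \<open>C\<close> are in state
  \<open>|1\<rangle>\<close> and is the identity otherwise. It is meant for \<open>C \<subseteq> {..<N}\<close>, \<open>t < N\<close> and \<open>t \<notin> C\<close>. For
  \<open>C = {}\<close> it is \<open>U\<close> on qubit \<open>t\<close>, tensored with the identity on the other qubits.
\<close>

definition controlled_mat :: "nat \<Rightarrow> nat set \<Rightarrow> nat \<Rightarrow> complex mat \<Rightarrow> complex mat" where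
  "controlled_mat N C t U = mat (2 ^ N) (2 ^ N) (\<lambda>(i, j).
     if \<forall>c\<in>C. bit j c
     then if \<forall>q<N. q \<noteq> t \<longrightarrow> bit i q = bit j q
          then U $$ (of_bool (bit i t), of_bool (bit j t))
          else 0
     else if i = j then 1 else 0)"

definition pauli_X :: "complex mat" where
  "pauli_X = mat 2 2 (\<lambda>(i, j). if i = j then 0 else 1)"

text \<open>The gate \<open>C\<^sup>nU\<close>, on \<open>n + 1\<close> qubits; its controls are \<open>0, \<dots>, n - 1\<close> and its target is \<open>n\<close>.\<close>

definition CnU :: "nat \<Rightarrow> complex mat \<Rightarrow> complex mat" where
  "CnU n U = controlled_mat (n + 1) {..<n} n U"

datatype gate =
    Single nat "complex mat"  \<comment> \<open>qubit, unitary\<close>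
  | CNOT nat nat              \<comment> \<open>control, target\<close>

fun gate_qubits :: "gate \<Rightarrow> nat set" where
  "gate_qubits (Single q U) = {q}"
| "gate_qubits (CNOT c t) = {c, t}"

fun valid_gate :: "nat \<Rightarrow> gate \<Rightarrow> bool" where
  "valid_gate N (Single q U) \<longleftrightarrow> q < N \<and> unitary_mat 2 U"
| "valid_gate N (CNOT c t) \<longleftrightarrow> c < N \<and> t < N \<and> c \<noteq> t"

fun gate_mat :: "nat \<Rightarrow> gate \<Rightarrow> complex mat" where
  "gate_mat N (Single q U) = controlled_mat N {} q U"
| "gate_mat N (CNOT c t) = controlled_mat N {c} t pauli_X"

text \<open>The first gate of the list is applied first.\<close>

type_synonym circuit = "gate list"

definition valid_circuit :: "nat \<Rightarrow> circuit \<Rightarrow> bool" where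
  "valid_circuit N gs \<longleftrightarrow> (\<forall>g\<in>set gs. valid_gate N g)"

fun circuit_mat :: "nat \<Rightarrow> circuit \<Rightarrow> complex mat" where
  "circuit_mat N [] = 1\<^sub>m (2 ^ N)"
| "circuit_mat N (g # gs) = circuit_mat N gs * gate_mat N g"

definition cnot_count :: "circuit \<Rightarrow> nat" where
  "cnot_count gs = length (filter (\<lambda>g. \<exists>c t. g = CNOT c t) gs)"

text \<open>
  \<open>layering gs d l\<close>: the gates of \<open>gs\<close> are arranged into \<open>d\<close> layers, gate number \<open>i\<close> going to
  layer \<open>l i\<close>. Gates that share a qubit keep their order, so that executing the layers one
  after the other still performs \<open>gs\<close>; as this order is strict, gates in the same layer act on
  disjoint qubits.
\<close>

definition layering :: "circuit \<Rightarrow> nat \<Rightarrow> (nat \<Rightarrow> nat) \<Rightarrow> bool" where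
  "layering gs d l \<longleftrightarrow>
     (\<forall>i<length gs. l i < d) \<and>
     (\<forall>j<length gs. \<forall>i<j. gate_qubits (gs ! i) \<inter> gate_qubits (gs ! j) \<noteq> {} \<longrightarrow> l i < l j)"

definition depth :: "circuit \<Rightarrow> nat" where
  "depth gs = (LEAST d. \<exists>l. layering gs d l)"

lemma ex_layering_depth: "\<exists>l. layering gs (depth gs) l"
proof -
  have "layering gs (length gs) (\<lambda>i. i)"
    by (simp add: layering_def)
  then have "\<exists>d l. layering gs d l"
    by blast
  then show ?thesis
    unfolding depth_def by (rule LeastI_ex)
qed

end

theory Submission
  imports Defs
begin

text \<open>
  The statement leaves \<open>\<theta>\<close> open, so we take \<open>\<theta> = 2 ^ 8 * pi\<close>: then \<open>n\<^sub>b = m + 8\<close>, where \<open>pi / 2 ^ m\<close>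
  is at most the admissible angle. Conjugating by single-qubit gates on the target, we may assume that
  \<open>U\<close> is diagonal with phases \<open>\<alpha>\<close>, \<open>\<beta>\<close>. Read \<open>m\<close> controls as a binary counter \<open>x\<close> and let the gate
  \<open>A\<close> apply the phase \<open>x * \<alpha> / 2 ^ m\<close> (\<open>x * \<beta> / 2 ^ m\<close> if the target is set), controlled by all
  remaining controls \<open>Y\<close>, and let \<open>B\<close> increment \<open>x\<close> modulo \<open>2 ^ m\<close>. In the group commutator of \<open>A\<close> and
  \<open>B\<close> the phases cancel up to \<open>- \<alpha> / 2 ^ m\<close>, except at the wrap-around \<open>x = 2 ^ m - 1\<close>, i.e. when all
  \<open>m\<close> controls are set, where the wanted phase \<open>\<alpha>\<close> is left over. The omitted phase \<open>\<alpha> / 2 ^ m\<close> is the error.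

  In a commutator it suffices that both gates are active together only if \<open>Y\<close> is all ones. So \<open>B\<close> is controlled
  by just three seed qubits of \<open>Y\<close>, and \<open>A\<close> by a qubit into which the conjunction of \<open>Y\<close> is computed
  correctly only if the seeds are set. This needs no ancillas: qubits of \<open>Y\<close> that have been
  consumed in a conjunction are known to be set whenever it matters and serve as workspace, which
  gives a tree of logarithmic depth with \<open>4 / 3\<close> relative-phase Toffoli gates (4 CNOTs each) per
  qubit. It is run four times, hence about \<open>64 / 3\<close> CNOTs per control.
\<close>

section \<open>Circuits as operators on amplitudes\<close>

type_synonym amplitude = "(nat \<Rightarrow> bool) \<Rightarrow> complex"

definition capply :: "nat set \<Rightarrow> nat \<Rightarrow> complex mat \<Rightarrow> amplitude \<Rightarrow> amplitude" where
  "capply C t U \<psi> = (\<lambda>z. if \<forall>c\<in>C. z c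
     then U $$ (of_bool (z t), 0) * \<psi> (z(t := False)) + U $$ (of_bool (z t), 1) * \<psi> (z(t := True))
     else \<psi> z)"

text \<open>Amplitudes take infinite bit assignments, so the action of a gate does not depend on the
  number of qubits. A permutation gate acts by substitution in the argument, that is, by pullback
  along its inverse.\<close>

fun gate_act :: "gate \<Rightarrow> amplitude \<Rightarrow> amplitude" where
  "gate_act (Single q U) \<psi> =
     (\<lambda>z. U $$ (of_bool (z q), 0) * \<psi> (z(q := False)) + U $$ (of_bool (z q), 1) * \<psi> (z(q := True)))"
| "gate_act (CNOT c t) \<psi> = (\<lambda>z. \<psi> (z(t := (z t \<noteq> z c))))"

fun act :: "circuit \<Rightarrow> amplitude \<Rightarrow> amplitude" where
  "act [] \<psi> = \<psi>"
| "act (g # gs) \<psi> = act gs (gate_act g \<psi>)"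

lemma act_append [simp]: "act (gs @ hs) \<psi> = act hs (act gs \<psi>)"
  by (induction gs arbitrary: \<psi>) auto

definition amp_vec :: "nat \<Rightarrow> amplitude \<Rightarrow> complex vec" where
  "amp_vec N \<psi> = vec (2 ^ N) (\<lambda>i. \<psi> (bit i))"

lemma dim_amp_vec [simp]: "dim_vec (amp_vec N \<psi>) = 2 ^ N"
  by (simp add: amp_vec_def)

lemma amp_vec_carrier [simp]: "amp_vec N \<psi> \<in> carrier_vec (2 ^ N)"
  by (simp add: amp_vec_def)

lemma not_bit_ge: "i < 2 ^ N \<Longrightarrow> N \<le> q \<Longrightarrow> \<not> bit (i :: nat) q"
  by (metis bit_take_bit_iff leD take_bit_nat_eq_self_iff)

lemma bit_set_bit_fun: "bit (set_bit q i) = (bit (i :: nat))(q := True)"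
  by (auto simp: fun_eq_iff bit_set_bit_iff possible_bit_def)

lemma bit_unset_bit_fun: "bit (unset_bit q i) = (bit (i :: nat))(q := False)"
  by (auto simp: fun_eq_iff bit_unset_bit_iff)

lemma bit_flip_bit_fun: "bit (flip_bit q i) = (bit (i :: nat))(q := \<not> bit i q)"
  by (auto simp: fun_eq_iff bit_flip_bit_iff possible_bit_def)

lemma flip_bit_flip_bit [simp]: "flip_bit q (flip_bit q i) = (i :: nat)"
  by (rule bit_eqI) (simp add: bit_flip_bit_fun)

lemma nat_less_2powI: "(\<And>q. N \<le> q \<Longrightarrow> \<not> bit i q) \<Longrightarrow> (i :: nat) < 2 ^ N"
proof -
  assume "\<And>q. N \<le> q \<Longrightarrow> \<not> bit i q"
  then have "take_bit N i = i"
    by (intro bit_eqI) (auto simp: bit_take_bit_iff not_le intro: leI)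
  then show ?thesis
    by (simp add: take_bit_nat_eq_self_iff)
qed

lemma set_bit_less: "i < 2 ^ N \<Longrightarrow> q < N \<Longrightarrow> set_bit q (i :: nat) < 2 ^ N"
  by (rule nat_less_2powI) (auto simp: bit_set_bit_fun not_bit_ge)

lemma unset_bit_less: "i < 2 ^ N \<Longrightarrow> unset_bit q (i :: nat) < 2 ^ N"
  by (rule nat_less_2powI) (auto simp: bit_unset_bit_fun not_bit_ge)

lemma flip_bit_less: "i < 2 ^ N \<Longrightarrow> q < N \<Longrightarrow> flip_bit q (i :: nat) < 2 ^ N"
  by (rule nat_less_2powI) (auto simp: bit_flip_bit_fun not_bit_ge)

text \<open>This locates the only two columns in which a row with set controls can be
  nonzero.\<close>

lemma agree_off_iff:
  assumes "i < 2 ^ N" "j < 2 ^ N" 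
  shows "(\<forall>q<N. q \<noteq> t \<longrightarrow> bit i q = bit j q) \<longleftrightarrow> (j :: nat) = set_bit t i \<or> j = unset_bit t i"
proof
  assume *: "\<forall>q<N. q \<noteq> t \<longrightarrow> bit i q = bit j q"
  have agree: "bit i q = bit j q" if "q \<noteq> t" for q
    using * that not_bit_ge[OF assms(1)] not_bit_ge[OF assms(2)] by (cases "q < N") auto
  have "bit j = bit (set_bit t i) \<or> bit j = bit (unset_bit t i)"
    unfolding bit_set_bit_fun bit_unset_bit_fun
    using agree by (cases "bit j t") (auto simp: fun_eq_iff)
  then show "j = set_bit t i \<or> j = unset_bit t i"
    by (auto intro: bit_eqI)
qed (auto simp: bit_set_bit_fun bit_unset_bit_fun)

lemma controlled_mat_carrier [simp]: "controlled_mat N C t U \<in> carrier_mat (2 ^ N) (2 ^ N)"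
  by (simp add: controlled_mat_def)

lemma controlled_mat_mult_amp_vec:
  assumes t: "t < N" "t \<notin> C"
  shows "controlled_mat N C t U *\<^sub>v amp_vec N \<psi> = amp_vec N (capply C t U \<psi>)"
proof (rule eq_vecI)
  show "dim_vec (controlled_mat N C t U *\<^sub>v amp_vec N \<psi>) = dim_vec (amp_vec N (capply C t U \<psi>))"
    by (simp add: controlled_mat_def)
  fix i assume "i < dim_vec (amp_vec N (capply C t U \<psi>))"
  then have i: "i < 2 ^ N" by simp
  define M where "M = (\<lambda>j. if \<forall>c\<in>C. bit j c
     then if \<forall>q<N. q \<noteq> t \<longrightarrow> bit i q = bit j q
          then U $$ (of_bool (bit i t), of_bool (bit j t)) else 0
     else if i = j then 1 else 0)"
  have "(controlled_mat N C t U *\<^sub>v amp_vec N \<psi>) $ i = (\<Sum>j<(2::nat) ^ N. M j * \<psi> (bit j))"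
    using i by (simp add: controlled_mat_def scalar_prod_def amp_vec_def M_def atLeast0LessThan)
  also have "\<dots> = capply C t U \<psi> (bit i)"
  proof (cases "\<forall>c\<in>C. bit i c")
    case True
    have C: "\<forall>c\<in>C. bit (set_bit t i) c" "\<forall>c\<in>C. bit (unset_bit t i) c"
      using True t by (auto simp: bit_set_bit_fun bit_unset_bit_fun)
    have ne: "set_bit t i \<noteq> unset_bit t i"
      by (metis bit_set_bit_fun bit_unset_bit_fun fun_upd_same)
    have "(\<Sum>j<(2::nat) ^ N. M j * \<psi> (bit j)) = (\<Sum>j\<in>{unset_bit t i, set_bit t i}. M j * \<psi> (bit j))"
    proof (rule sum.mono_neutral_right)
      show "\<forall>j\<in>{..<2 ^ N} - {unset_bit t i, set_bit t i}. M j * \<psi> (bit j) = 0"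
      proof
        fix j assume "j \<in> {..<2 ^ N} - {unset_bit t i, set_bit t i}"
        then have j: "j < 2 ^ N" "\<not> (\<forall>q<N. q \<noteq> t \<longrightarrow> bit i q = bit j q)"
          using agree_off_iff[OF i, of j t] by auto
        then have "i \<noteq> j" by auto
        then show "M j * \<psi> (bit j) = 0"
          using j(2) \<open>i \<noteq> j\<close> by (simp only: M_def if_False if_cancel mult_zero_left)
      qed
    qed (use i t in \<open>auto intro: set_bit_less unset_bit_less\<close>)
    also have "\<dots> = capply C t U \<psi> (bit i)"
      using True C ne t(2) agree_off_iff[OF i set_bit_less[OF i t(1)], of t] 
        agree_off_iff[OF i unset_bit_less[OF i], of t t]
      by (simp add: M_def capply_def bit_set_bit_fun bit_unset_bit_fun)
    finally show ?thesis .
  next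
    case False
    have "(\<Sum>j<(2::nat) ^ N. M j * \<psi> (bit j)) = (\<Sum>j\<in>{i}. M j * \<psi> (bit j))"
    proof (rule sum.mono_neutral_right)
      show "\<forall>j\<in>{..<2 ^ N} - {i}. M j * \<psi> (bit j) = 0"
      proof
        fix j assume "j \<in> {..<2 ^ N} - {i}"
        then have j: "j < 2 ^ N" "i \<noteq> j" by auto
        \<comment> \<open>Since \<open>t\<close> is not a control, agreement of \<open>i\<close> and
          \<open>j\<close> off \<open>t\<close> would carry the set controls of \<open>j\<close>
          over to \<open>i\<close>.\<close>
        have "\<not> (\<forall>q<N. q \<noteq> t \<longrightarrow> bit i q = bit j q)" if "\<forall>c\<in>C. bit j c"
        proof
          assume "\<forall>q<N. q \<noteq> t \<longrightarrow> bit i q = bit j q"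
          then have "j = set_bit t i \<or> j = unset_bit t i"
            using agree_off_iff[OF i j(1)] by blast
          then have "\<forall>c\<in>C. bit i c"
            using that t by (auto simp: bit_set_bit_fun bit_unset_bit_fun split: if_splits)
          with False show False by blast
        qed
        then show "M j * \<psi> (bit j) = 0"
          using j(2) by (cases "\<forall>c\<in>C. bit j c") (simp_all only: M_def if_False if_True if_cancel mult_zero_left simp_thms)
      qed
    qed (use i in auto)
    then show ?thesis
      using False by (auto simp: M_def capply_def)
  qed
  finally show "(controlled_mat N C t U *\<^sub>v amp_vec N \<psi>) $ i = amp_vec N (capply C t U \<psi>) $ i"
    using i by (simp add: amp_vec_def)
qed

lemma gate_mat_mult_amp_vec:
  "valid_gate N g \<Longrightarrow> gate_mat N g *\<^sub>v amp_vec N \<psi> = amp_vec N (gate_act g \<psi>)"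
proof (cases g)
  case (CNOT c t)
  have "capply {c} t pauli_X \<psi> = gate_act g \<psi>"
    unfolding CNOT capply_def by (rule ext) (auto simp: pauli_X_def fun_upd_idem)
  then show "valid_gate N g \<Longrightarrow> ?thesis"
    by (simp add: CNOT controlled_mat_mult_amp_vec)
qed (simp add: controlled_mat_mult_amp_vec capply_def)

lemma gate_mat_carrier [simp]: "gate_mat N g \<in> carrier_mat (2 ^ N) (2 ^ N)"
  by (cases g) auto

lemma circuit_mat_carrier [simp]: "circuit_mat N gs \<in> carrier_mat (2 ^ N) (2 ^ N)"
  by (induction gs) (auto intro: mult_carrier_mat)

lemma circuit_mat_mult_amp_vec:
  "valid_circuit N gs \<Longrightarrow> circuit_mat N gs *\<^sub>v amp_vec N \<psi> = amp_vec N (act gs \<psi>)"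
proof (induction gs arbitrary: \<psi>)
  case (Cons g gs)
  then have *: "valid_gate N g" "valid_circuit N gs" by (auto simp: valid_circuit_def)
  have "circuit_mat N (g # gs) *\<^sub>v amp_vec N \<psi> = circuit_mat N gs *\<^sub>v (gate_mat N g *\<^sub>v amp_vec N \<psi>)"
    unfolding circuit_mat.simps
    by (rule assoc_mult_mat_vec[of _ "2^N" "2^N" _ "2^N"]) auto
  then show ?case
    using Cons.IH[OF *(2)] gate_mat_mult_amp_vec[OF *(1)] by simp
qed simp

lemma vec_eq_amp_vec:
  assumes "v \<in> carrier_vec (2 ^ N)"
  obtains \<psi> where "v = amp_vec N \<psi>"
proof
  \<comment> \<open>As \<open>bit\<close> is injective, the definite description recovers an index
    from its digits.\<close>
  show "v = amp_vec N (\<lambda>z. v $ (THE i. bit i = z))"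
  proof (rule eq_vecI)
    fix i assume "i < dim_vec (amp_vec N (\<lambda>z. v $ (THE i. bit i = z)))"
    moreover have "(THE j. bit j = bit i) = i"
      by (rule the_equality) (auto intro: bit_eqI)
    ultimately show "v $ i = amp_vec N (\<lambda>z. v $ (THE i. bit i = z)) $ i"
      by (simp add: amp_vec_def)
  qed (use assms in auto)
qed

section \<open>Euclidean and spectral norms\<close>

lemma euclid_norm_amp_vec:
  "(euclid_norm (amp_vec N \<psi>))\<^sup>2 = (\<Sum>i<2 ^ N. (cmod (\<psi> (bit (i :: nat))))\<^sup>2)"
  by (simp add: euclid_norm_def L2_set_def amp_vec_def sum_nonneg)

lemma euclid_norm_nonneg: "0 \<le> euclid_norm v"
  by (simp add: euclid_norm_def)

text \<open>Summing over each pair of basis states that differ in qubit \<open>q\<close> twice reduces the claim to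
  the two-dimensional case.\<close>

lemma euclid_norm_Single:
  assumes U: "cmod (U $$ (0,0)) ^ 2 + cmod (U $$ (1,0)) ^ 2 = 1"
      "cmod (U $$ (0,1)) ^ 2 + cmod (U $$ (1,1)) ^ 2 = 1"
      "U $$ (0,0) * cnj (U $$ (0,1)) + U $$ (1,0) * cnj (U $$ (1,1)) = 0"
    and q: "q < N"
  shows "euclid_norm (amp_vec N (gate_act (Single q U) \<psi>)) = euclid_norm (amp_vec N \<psi>)"
proof -
  define G where "G = (\<lambda>\<chi> :: amplitude. \<Sum>i<2 ^ N. (cmod (\<chi> (bit (i :: nat))))\<^sup>2)"
  have dbl: "2 * G \<chi> = (\<Sum>i<2 ^ N. (cmod (\<chi> ((bit (i :: nat))(q := False))))\<^sup>2 
      + (cmod (\<chi> ((bit i)(q := True))))\<^sup>2)" for \<chi>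
  proof -
    have "G \<chi> = (\<Sum>i<2 ^ N. (cmod (\<chi> (bit (flip_bit q (i :: nat)))))\<^sup>2)"
      unfolding G_def 
      by (rule sum.reindex_bij_witness[of _ "flip_bit q" "flip_bit q"])
        (auto simp: q flip_bit_less)
    then have "2 * G \<chi> = (\<Sum>i<2 ^ N. (cmod (\<chi> (bit i)))\<^sup>2 + (cmod (\<chi> (bit (flip_bit q (i :: nat)))))\<^sup>2)"
      by (simp add: G_def sum.distrib)
    also have "\<dots> = (\<Sum>i<2 ^ N. (cmod (\<chi> ((bit (i :: nat))(q := False))))\<^sup>2 
      + (cmod (\<chi> ((bit i)(q := True))))\<^sup>2)"
    proof (rule sum.cong[OF refl])
      fix i :: nat
      show "(cmod (\<chi> (bit i)))\<^sup>2 + (cmod (\<chi> (bit (flip_bit q i))))\<^sup>2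
        = (cmod (\<chi> ((bit i)(q := False))))\<^sup>2 + (cmod (\<chi> ((bit i)(q := True))))\<^sup>2"
        by (cases "bit i q") (simp_all add: bit_flip_bit_fun fun_upd_idem)
    qed
    finally show ?thesis .
  qed
  have two: "(cmod (U $$ (0,0) * x + U $$ (0,1) * y))\<^sup>2 + (cmod (U $$ (1,0) * x + U $$ (1,1) * y))\<^sup>2
     = (cmod x)\<^sup>2 + (cmod y)\<^sup>2" for x y
  proof -
    let ?a = "U $$ (0,0)" and ?b = "U $$ (0,1)" and ?c = "U $$ (1,0)" and ?d = "U $$ (1,1)"
    have n: "?a * cnj ?a + ?c * cnj ?c = 1" "?b * cnj ?b + ?d * cnj ?d = 1"
      using U(1,2) by (metis complex_norm_square of_real_1 of_real_add)+
    have o: "?a * cnj ?b + ?c * cnj ?d = 0" by (rule U(3))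
    then have o': "cnj ?a * ?b + cnj ?c * ?d = 0"
      by (metis complex_cnj_add complex_cnj_cnj complex_cnj_mult complex_cnj_zero)
    have "(?a * x + ?b * y) * cnj (?a * x + ?b * y) + (?c * x + ?d * y) * cnj (?c * x + ?d * y)
       = (?a * cnj ?a + ?c * cnj ?c) * (x * cnj x) + (?b * cnj ?b + ?d * cnj ?d) * (y * cnj y)
         + (?a * cnj ?b + ?c * cnj ?d) * (x * cnj y) + (cnj ?a * ?b + cnj ?c * ?d) * (cnj x * y)"
      by (simp add: algebra_simps)
    also have "\<dots> = x * cnj x + y * cnj y"
      by (simp only: n o o') simp
    finally show ?thesis
      unfolding complex_norm_square[symmetric] of_real_add[symmetric] of_real_eq_iff .
  qed
  have "2 * G (gate_act (Single q U) \<psi>) = 2 * G \<psi>"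
    unfolding dbl by (rule sum.cong) (simp_all add: two[unfolded One_nat_def])
  then have "(euclid_norm (amp_vec N (gate_act (Single q U) \<psi>)))\<^sup>2 = (euclid_norm (amp_vec N \<psi>))\<^sup>2"
    by (simp only: euclid_norm_amp_vec G_def)
  then show ?thesis
    by (simp add: euclid_norm_nonneg)
qed

lemma euclid_norm_diag_le:
  assumes "\<And>z. cmod (D z) \<le> \<epsilon>"
  shows "euclid_norm (amp_vec N (\<lambda>z. D z * \<psi> z)) \<le> \<epsilon> * euclid_norm (amp_vec N \<psi>)"
proof (rule power2_le_imp_le)
  have e: "0 \<le> \<epsilon>" using assms[of "\<lambda>_. False"] norm_ge_zero order_trans by blast
  then show "0 \<le> \<epsilon> * euclid_norm (amp_vec N \<psi>)"
    by (simp add: euclid_norm_nonneg)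
  have "(\<Sum>i<2 ^ N. (cmod (D (bit (i :: nat)) * \<psi> (bit i)))\<^sup>2) \<le> (\<Sum>i<2 ^ N. \<epsilon>\<^sup>2 * (cmod (\<psi> (bit (i :: nat))))\<^sup>2)"
    by (rule sum_mono) (auto simp: norm_mult power_mult_distrib intro!: mult_right_mono power_mono assms)
  then show "(euclid_norm (amp_vec N (\<lambda>z. D z * \<psi> z)))\<^sup>2 \<le> (\<epsilon> * euclid_norm (amp_vec N \<psi>))\<^sup>2"
    by (simp add: euclid_norm_amp_vec power_mult_distrib sum_distrib_left)
qed

lemma spectral_norm_leI:
  assumes A: "A \<in> carrier_mat (2 ^ N) (2 ^ N)"
    and le: "\<And>\<psi>. euclid_norm (A *\<^sub>v amp_vec N \<psi>) \<le> \<epsilon> * euclid_norm (amp_vec N \<psi>)"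
  shows "spectral_norm A \<le> \<epsilon>"
  unfolding spectral_norm_def
proof (rule cSUP_least)
  \<comment> \<open>Bounding the supremum requires a nonempty unit sphere; the basis state with
    index 0 lies on it.\<close>
  let ?\<psi> = "\<lambda>z :: nat \<Rightarrow> bool. of_bool (z = bit (0 :: nat)) :: complex"
  have "(\<Sum>i<2 ^ N. (cmod (?\<psi> (bit (i :: nat))))\<^sup>2) = (\<Sum>i\<in>{0 :: nat}. 1)"
  proof (rule sum.mono_neutral_cong_right)
    show "\<forall>i\<in>{..<2 ^ N} - {0 :: nat}. (cmod (?\<psi> (bit i)))\<^sup>2 = 0"
      by (auto simp: fun_eq_iff) (metis bit_eqI bit_0_eq bot_apply bot_bool_def)
  qed (auto)
  then have "(euclid_norm (amp_vec N ?\<psi>))\<^sup>2 = 1"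
    by (simp add: euclid_norm_amp_vec)
  then have "euclid_norm (amp_vec N ?\<psi>) = 1"
    using euclid_norm_nonneg by (simp add: power2_eq_1_iff) (metis le_minus_one_simps(3))
  then show "{v \<in> carrier_vec (dim_col A). euclid_norm v = 1} \<noteq> {}"
    using A by (auto intro!: exI[of _ "amp_vec N ?\<psi>"])
next
  fix v assume "v \<in> {v \<in> carrier_vec (dim_col A). euclid_norm v = 1}"
  then have "v \<in> carrier_vec (2 ^ N)" "euclid_norm v = 1" using A by auto
  then show "euclid_norm (A *\<^sub>v v) \<le> \<epsilon>"
    using le by (metis mult.right_neutral vec_eq_amp_vec)
qed

section \<open>CNOT count, support and depth of circuits\<close>

lemma cnot_count_simps [simp]:
  "cnot_count [] = 0" "cnot_count (CNOT c t # gs) = Suc (cnot_count gs)"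
  "cnot_count (Single q U # gs) = cnot_count gs"
  "cnot_count (gs @ hs) = cnot_count gs + cnot_count hs"
  by (auto simp: cnot_count_def)

lemma valid_circuit_simps [simp]:
  "valid_circuit N []" "valid_circuit N (g # gs) \<longleftrightarrow> valid_gate N g \<and> valid_circuit N gs"
  "valid_circuit N (gs @ hs) \<longleftrightarrow> valid_circuit N gs \<and> valid_circuit N hs"
  by (auto simp: valid_circuit_def)

definition circuit_qubits :: "circuit \<Rightarrow> nat set" where
  "circuit_qubits gs = (\<Union>g\<in>set gs. gate_qubits g)"

lemma circuit_qubits_simps [simp]:
  "circuit_qubits [] = {}" "circuit_qubits (g # gs) = gate_qubits g \<union> circuit_qubits gs"
  "circuit_qubits (gs @ hs) = circuit_qubits gs \<union> circuit_qubits hs"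
  by (auto simp: circuit_qubits_def)

lemma depth_le: "layering gs d l \<Longrightarrow> depth gs \<le> d"
  unfolding depth_def by (rule Least_le) blast

lemma depth_le_length: "depth gs \<le> length gs"
  by (rule depth_le[of _ _ "\<lambda>i. i"]) (simp add: layering_def)

text \<open>The layers of \<open>hs\<close> are placed after those of \<open>gs\<close>.\<close>

lemma depth_append: "depth (gs @ hs) \<le> depth gs + depth hs"
proof -
  obtain l k where l: "layering gs (depth gs) l" and k: "layering hs (depth hs) k"
    using ex_layering_depth by blast
  have "layering (gs @ hs) (depth gs + depth hs)
    (\<lambda>i. if i < length gs then l i else depth gs + k (i - length gs))"
    unfolding layering_def
  proof (intro conjI allI impI)
    fix i assume "i < length (gs @ hs)"
    then show "(if i < length gs then l i else depth gs + k (i - length gs)) < depth gs + depth hs"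
      using l k by (auto simp: layering_def trans_less_add1)
  next
    fix j i assume j: "j < length (gs @ hs)" and i: "i < j"
      and q: "gate_qubits ((gs @ hs) ! i) \<inter> gate_qubits ((gs @ hs) ! j) \<noteq> {}"
    consider "j < length gs" | "i < length gs" "length gs \<le> j" | "length gs \<le> i"
      by linarith
    then show "(if i < length gs then l i else depth gs + k (i - length gs))
      < (if j < length gs then l j else depth gs + k (j - length gs))"
    proof cases
      case 3
      then have "j - length gs < length hs" "i - length gs < j - length gs" "length gs \<le> j"
        using i j by auto
      then show ?thesis
        using 3 q k by (auto simp: layering_def nth_append)
    qed (use i j q l k in \<open>auto simp: layering_def nth_append trans_less_add1\<close>)
  qed
  then show ?thesis by (rule depth_le)
qed

text \<open>No gate of one circuit constrains a gate of the other, so the two layerings can be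
  superimposed. This lets the two branches of a tree run in parallel.\<close>

lemma depth_append_disjoint:
  assumes "circuit_qubits gs \<inter> circuit_qubits hs = {}"
  shows "depth (gs @ hs) \<le> max (depth gs) (depth hs)"
proof -
  obtain l k where l: "layering gs (depth gs) l" and k: "layering hs (depth hs) k"
    using ex_layering_depth by blast
  have "layering (gs @ hs) (max (depth gs) (depth hs))
    (\<lambda>i. if i < length gs then l i else k (i - length gs))"
    unfolding layering_def
  proof (intro conjI allI impI)
    fix i assume "i < length (gs @ hs)"
    then show "(if i < length gs then l i else k (i - length gs)) < max (depth gs) (depth hs)"
      using l k by (auto simp: layering_def less_max_iff_disj)
  next
    fix j i assume j: "j < length (gs @ hs)" and i: "i < j"
      and q: "gate_qubits ((gs @ hs) ! i) \<inter> gate_qubits ((gs @ hs) ! j) \<noteq> {}"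
    consider "j < length gs" | "i < length gs" "length gs \<le> j" | "length gs \<le> i"
      by linarith
    then show "(if i < length gs then l i else k (i - length gs))
      < (if j < length gs then l j else k (j - length gs))"
    proof cases
      case 2
      then have "gs ! i \<in> set gs" "hs ! (j - length gs) \<in> set hs"
        using j by auto
      then have "gate_qubits (gs ! i) \<inter> gate_qubits (hs ! (j - length gs)) = {}"
        using assms by (auto simp: circuit_qubits_def)
      then show ?thesis
        using 2 q by (simp add: nth_append)
    next
      case 3
      then have "j - length gs < length hs" "i - length gs < j - length gs" "length gs \<le> j"
        using i j by auto
      then show ?thesis
        using 3 q k by (auto simp: layering_def nth_append)
    qed (use i j q l in \<open>auto simp: layering_def nth_append\<close>)
  qed
  then show ?thesis by (rule depth_le)
qed

section \<open>Two-by-two matrices\<close>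

definition mat2 :: "complex \<Rightarrow> complex \<Rightarrow> complex \<Rightarrow> complex \<Rightarrow> complex mat" where
  "mat2 a b c d = mat 2 2 (\<lambda>(i, j). if i = 0 then if j = 0 then a else b else if j = 0 then c else d)"

lemma mat2_index [simp]:
  "mat2 a b c d $$ (0, 0) = a" "mat2 a b c d $$ (0, Suc 0) = b"
  "mat2 a b c d $$ (Suc 0, 0) = c" "mat2 a b c d $$ (Suc 0, Suc 0) = d"
  by (auto simp: mat2_def)

lemma mat2_dim [simp]: "dim_row (mat2 a b c d) = 2" "dim_col (mat2 a b c d) = 2" 
    "mat2 a b c d \<in> carrier_mat 2 2"
  by (auto simp: mat2_def)

lemma mat2_eta:
  assumes "U \<in> carrier_mat 2 2"
  shows "U = mat2 (U $$ (0,0)) (U $$ (0,1)) (U $$ (1,0)) (U $$ (1,1))"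
proof (rule eq_matI)
  fix i j assume "i < dim_row (mat2 (U $$ (0,0)) (U $$ (0,1)) (U $$ (1,0)) (U $$ (1,1)))"
    "j < dim_col (mat2 (U $$ (0,0)) (U $$ (0,1)) (U $$ (1,0)) (U $$ (1,1)))"
  then have "i = 0 \<or> i = 1" "j = 0 \<or> j = 1" by auto
  then show "U $$ (i, j) = mat2 (U $$ (0,0)) (U $$ (0,1)) (U $$ (1,0)) (U $$ (1,1)) $$ (i, j)"
    by (elim disjE) (simp_all only: One_nat_def mat2_index)
qed (use assms in \<open>simp_all only: carrier_matD mat2_dim\<close>)

lemma mat_adjoint_carrier [simp]: "A \<in> carrier_mat n n \<Longrightarrow> mat_adjoint A \<in> carrier_mat n n"
  unfolding mat_adjoint_def by auto

lemma mat_adjoint_index: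
  "A \<in> carrier_mat n n \<Longrightarrow> i < n \<Longrightarrow> j < n \<Longrightarrow> mat_adjoint A $$ (i, j) = cnj (A $$ (j, i))"
  by (simp add: mat_adjoint_def mat_of_rows_def)

lemma mat_adjoint_mat2: "mat_adjoint (mat2 a b c d) = mat2 (cnj a) (cnj c) (cnj b) (cnj d)"
  by (rule eq_matI)
    (use mat_adjoint_carrier[OF mat2_dim(3), of a b c d, unfolded carrier_mat_def] 
      in \<open>auto simp: mat_adjoint_index[OF mat2_dim(3)] less_2_cases_iff\<close>)

lemma mat2_eqI:
  "A \<in> carrier_mat 2 2 \<Longrightarrow> A $$ (0, 0) = a \<Longrightarrow> A $$ (0, 1) = b \<Longrightarrow> A $$ (1, 0) = c \<Longrightarrow> A $$ (1, 1) = d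
    \<Longrightarrow> A = mat2 a b c d"
  using mat2_eta by blast

lemma mult_mat2:
  "mat2 a b c d * mat2 a' b' c' d' = mat2 (a*a' + b*c') (a*b' + b*d') (c*a' + d*c') (c*b' + d*d')"
proof (rule mat2_eqI)
  show "mat2 a b c d * mat2 a' b' c' d' \<in> carrier_mat 2 2"
    by (rule mult_carrier_mat[of _ 2 2]) simp_all
qed (simp_all add: scalar_prod_def numeral_2_eq_2)

lemma one_mat2: "1\<^sub>m 2 = mat2 1 0 0 1"
  by (rule mat2_eqI) simp_all

lemma mat2_eq_iff: "mat2 a b c d = mat2 a' b' c' d' \<longleftrightarrow> a = a' \<and> b = b' \<and> c = c' \<and> d = d'"
  by (auto dest: arg_cong[where f = "\<lambda>M. (M $$ (0, 0), M $$ (0, 1), M $$ (1, 0), M $$ (1, 1))"])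

lemma unitary_mat2_iff:
  "unitary_mat 2 (mat2 a b c d) \<longleftrightarrow> cnj a * a + cnj c * c = 1 \<and> cnj a * b + cnj c * d = 0 \<and>
     cnj b * a + cnj d * c = 0 \<and> cnj b * b + cnj d * d = 1"
  by (simp add: unitary_mat_def mat_adjoint_mat2 mult_mat2 one_mat2 mat2_eq_iff)

text \<open>A left inverse of a square matrix is also a right inverse.\<close>

lemma unitary_mat2_adjoint:
  assumes "unitary_mat 2 U"
  shows "unitary_mat 2 (mat_adjoint U)" "mat_adjoint (mat_adjoint U) = U"
proof -
  have U: "U \<in> carrier_mat 2 2" "mat_adjoint U * U = 1\<^sub>m 2"
    using assms by (auto simp: unitary_mat_def)
  obtain a b c d where "U = mat2 a b c d"
    using mat2_eta[OF U(1)] by blast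
  then show adj: "mat_adjoint (mat_adjoint U) = U"
    by (simp add: mat_adjoint_mat2)
  show "unitary_mat 2 (mat_adjoint U)"
    using mat_mult_left_right_inverse[OF mat_adjoint_carrier[OF U(1)] U(1) U(2)] U(1) 
    by (simp add: unitary_mat_def adj)
qed

section \<open>Inverse circuits\<close>

fun inv_gate :: "gate \<Rightarrow> gate" where
  "inv_gate (Single q U) = Single q (mat_adjoint U)"
| "inv_gate (CNOT c t) = CNOT c t"

definition inv_circuit :: "circuit \<Rightarrow> circuit" where
  "inv_circuit gs = rev (map inv_gate gs)"

lemma inv_circuit_simps [simp]:
  "inv_circuit [] = []" "inv_circuit (g # gs) = inv_circuit gs @ [inv_gate g]"
  "inv_circuit (gs @ hs) = inv_circuit hs @ inv_circuit gs"
  by (auto simp: inv_circuit_def)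

lemma gate_qubits_inv [simp]: "gate_qubits (inv_gate g) = gate_qubits g"
  by (cases g) auto

lemma valid_inv_gate: "valid_gate N g \<Longrightarrow> valid_gate N (inv_gate g) \<and> inv_gate (inv_gate g) = g"
  by (cases g) (auto simp: unitary_mat2_adjoint)

lemma valid_inv_circuit: 
  "valid_circuit N gs \<Longrightarrow> valid_circuit N (inv_circuit gs) \<and> inv_circuit (inv_circuit gs) = gs"
  by (induction gs) (auto simp: valid_inv_gate)

lemma cnot_count_inv [simp]: "cnot_count (inv_circuit gs) = cnot_count gs"
proof (induction gs)
  case (Cons g gs)
  then show ?case by (cases g) auto
qed simp

lemma depth_inv: "depth (inv_circuit gs) \<le> depth gs"
proof -
  obtain l where l: "layering gs (depth gs) l"
    using ex_layering_depth by blast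
  let ?n = "length gs"
  \<comment> \<open>Time reversal: gate positions and layers are both counted from the end.\<close>
  have "layering (inv_circuit gs) (depth gs) (\<lambda>i. depth gs - Suc (l (?n - Suc i)))"
    unfolding layering_def
  proof (intro conjI allI impI)
    fix i assume "i < length (inv_circuit gs)"
    then have "i < ?n" by (simp add: inv_circuit_def)
    then have "l (?n - Suc i) < depth gs" using l by (simp add: layering_def)
    then show "depth gs - Suc (l (?n - Suc i)) < depth gs" by simp
  next
    fix j i assume "j < length (inv_circuit gs)" and i: "i < j"
      and q: "gate_qubits (inv_circuit gs ! i) \<inter> gate_qubits (inv_circuit gs ! j) \<noteq> {}"
    then have j: "j < ?n" by (simp add: inv_circuit_def)
    then have "gate_qubits (gs ! (?n - Suc j)) \<inter> gate_qubits (gs ! (?n - Suc i)) \<noteq> {}"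
      using q i by (auto simp: inv_circuit_def rev_nth)
    moreover have "?n - Suc j < ?n - Suc i" "?n - Suc i < ?n" using i j by auto
    ultimately have "l (?n - Suc j) < l (?n - Suc i)" "l (?n - Suc i) < depth gs" 
      using l unfolding layering_def by blast+
    then show "depth gs - Suc (l (?n - Suc i)) < depth gs - Suc (l (?n - Suc j))" by simp
  qed
  then show ?thesis by (rule depth_le)
qed

lemma gate_act_inv:
  assumes "valid_gate N g"
  shows "gate_act (inv_gate g) (gate_act g \<psi>) = \<psi>"
proof (cases g)
  case (Single q U)
  then have U: "unitary_mat 2 U" using assms by simp
  obtain a b c d where abcd: "U = mat2 a b c d"
    using U mat2_eta unfolding unitary_mat_def by blast
  have e: "cnj a * a + cnj c * c = 1" "cnj a * b + cnj c * d = 0"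
     "cnj b * a + cnj d * c = 0" "cnj b * b + cnj d * d = 1"
    using U unfolding abcd unitary_mat2_iff by auto
  have "cnj a * (a * x + b * y) + cnj c * (c * x + d * y) = x"
    "cnj b * (a * x + b * y) + cnj d * (c * x + d * y) = y" for x y
  proof -
    have "cnj a * (a * x + b * y) + cnj c * (c * x + d * y) 
      = (cnj a * a + cnj c * c) * x + (cnj a * b + cnj c * d) * y"
      "cnj b * (a * x + b * y) + cnj d * (c * x + d * y)
      = (cnj b * a + cnj d * c) * x + (cnj b * b + cnj d * d) * y"
      by (simp_all add: algebra_simps)
    then show "cnj a * (a * x + b * y) + cnj c * (c * x + d * y) = x"
      "cnj b * (a * x + b * y) + cnj d * (c * x + d * y) = y"
      by (simp_all add: e)
  qed
  then show ?thesis
    by (auto simp: Single abcd mat_adjoint_mat2 fun_eq_iff fun_upd_idem)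
next
  case (CNOT c t)
  have "z(t := ((z t \<noteq> z c) \<noteq> z c)) = z" for z :: "nat \<Rightarrow> bool"
    by (rule fun_upd_idem) blast
  then show ?thesis
    using assms by (simp add: CNOT)
qed

lemma act_inv:
  assumes "valid_circuit N gs"
  shows "act (inv_circuit gs) (act gs \<psi>) = \<psi>" "act gs (act (inv_circuit gs) \<psi>) = \<psi>"
proof -
  have *: "act (inv_circuit gs) (act gs \<psi>) = \<psi>" if "valid_circuit N gs" for gs \<psi>
    using that by (induction gs arbitrary: \<psi>) (auto simp: gate_act_inv)
  show "act (inv_circuit gs) (act gs \<psi>) = \<psi>" by (rule *[OF assms])
  show "act gs (act (inv_circuit gs) \<psi>) = \<psi>" 
    using *[of "inv_circuit gs" \<psi>] valid_inv_circuit[OF assms] by simp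
qed

section \<open>Diagonal circuits\<close>

definition diag_act :: "circuit \<Rightarrow> ((nat \<Rightarrow> bool) \<Rightarrow> real) \<Rightarrow> bool" where
  "diag_act gs \<phi> \<longleftrightarrow> (\<forall>\<psi>. act gs \<psi> = (\<lambda>z. cis (\<phi> z) * \<psi> z))"

lemma diag_actD: "diag_act gs \<phi> \<Longrightarrow> act gs \<psi> = (\<lambda>z. cis (\<phi> z) * \<psi> z)"
  by (simp add: diag_act_def)

lemma diag_act_Nil: "diag_act [] (\<lambda>z. 0)"
  by (simp add: diag_act_def)

text \<open>Phases are recorded as real angles, so composition becomes addition and the commutator
  can be evaluated by real arithmetic.\<close>

lemma diag_act_append: "diag_act gs \<phi> \<Longrightarrow> diag_act hs \<chi> \<Longrightarrow> diag_act (gs @ hs) (\<lambda>z. \<phi> z + \<chi> z)"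
  by (simp add: diag_act_def cis_mult[symmetric] ac_simps)

lemma diag_act_cong: "diag_act gs \<phi> \<Longrightarrow> (\<And>z. \<phi> z = \<chi> z) \<Longrightarrow> diag_act gs \<chi>"
  by (simp add: diag_act_def)

lemma diag_act_inv:
  assumes "diag_act gs \<phi>" "valid_circuit N gs"
  shows "diag_act (inv_circuit gs) (\<lambda>z. - \<phi> z)"
  unfolding diag_act_def
proof (intro allI ext)
  fix \<psi> z
  have "act gs (act (inv_circuit gs) \<psi>) z = \<psi> z"
    using act_inv(2)[OF assms(2)] by simp
  then have "cis (\<phi> z) * act (inv_circuit gs) \<psi> z = \<psi> z"
    using assms(1) by (simp add: diag_act_def)
  then have "cis (- \<phi> z) * \<psi> z = cis (- \<phi> z) * cis (\<phi> z) * act (inv_circuit gs) \<psi> z"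
    by simp
  then show "act (inv_circuit gs) \<psi> z = cis (- \<phi> z) * \<psi> z"
    by (simp add: cis_mult)
qed

lemma diag_act_CNOT_conj:
  assumes "diag_act gs \<phi>" "a \<noteq> b"
  shows "diag_act (CNOT a b # gs @ [CNOT a b]) (\<lambda>z. \<phi> (z(b := (z b \<noteq> z a))))"
proof -
  have "z(b := ((z b \<noteq> z a) \<noteq> z a)) = z" for z :: "nat \<Rightarrow> bool"
    by (rule fun_upd_idem) blast
  then show ?thesis
    using assms by (simp add: diag_act_def)
qed

section \<open>Multiply controlled phases\<close>

definition phase_gate :: "real \<Rightarrow> nat \<Rightarrow> gate" where
  "phase_gate \<phi> q = Single q (mat2 1 0 0 (cis \<phi>))"

lemma valid_phase_gate [simp]: "valid_gate N (phase_gate \<phi> q) \<longleftrightarrow> q < N"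
  by (simp add: phase_gate_def unitary_mat2_iff cis_cnj cis_mult)

lemma gate_qubits_phase_gate [simp]: "gate_qubits (phase_gate \<phi> q) = {q}"
  by (simp add: phase_gate_def)

lemma cnot_count_phase_gate [simp]: "cnot_count (phase_gate \<phi> q # gs) = cnot_count gs"
  by (simp add: phase_gate_def)

lemma diag_act_phase_gate: "diag_act [phase_gate \<phi> q] (\<lambda>z. \<phi> * of_bool (z q))"
  by (auto simp: diag_act_def phase_gate_def fun_eq_iff fun_upd_idem)

text \<open>Halving rests on \<open>2 a b = a + b - (a \<oplus> b)\<close> for bits \<open>a\<close>, \<open>b\<close>.\<close>

fun phase_circuit :: "real \<Rightarrow> nat list \<Rightarrow> circuit" where
  "phase_circuit \<phi> [] = []"
| "phase_circuit \<phi> [q] = [phase_gate \<phi> q]"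
| "phase_circuit \<phi> (a # b # qs) = phase_circuit (\<phi> / 2) (a # qs) @ phase_circuit (\<phi> / 2) (b # qs) @
     (CNOT a b # phase_circuit (- \<phi> / 2) (b # qs) @ [CNOT a b])"

lemma diag_act_phase_circuit:
  "qs \<noteq> [] \<Longrightarrow> distinct qs \<Longrightarrow> diag_act (phase_circuit \<phi> qs) (\<lambda>z. \<phi> * of_bool (\<forall>q\<in>set qs. z q))"
proof (induction \<phi> qs rule: phase_circuit.induct)
  case (2 \<phi> q)
  show ?case using diag_act_phase_gate by simp
next
  case (3 \<phi> a b qs)
  have n: "a \<noteq> b" "a \<notin> set qs" "b \<notin> set qs" using 3 by auto
  have i: "diag_act (phase_circuit (\<phi> / 2) (a # qs)) (\<lambda>z. \<phi> / 2 * of_bool (\<forall>q\<in>set (a # qs). z q))"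
    "diag_act (phase_circuit (\<phi> / 2) (b # qs)) (\<lambda>z. \<phi> / 2 * of_bool (\<forall>q\<in>set (b # qs). z q))"
    "diag_act (phase_circuit (- \<phi> / 2) (b # qs)) (\<lambda>z. - \<phi> / 2 * of_bool (\<forall>q\<in>set (b # qs). z q))"
    using 3 by auto
  have upd: "(\<forall>q\<in>set qs. (z(b := v)) q) \<longleftrightarrow> (\<forall>q\<in>set qs. z q)" for z v
    using n by auto
  show ?case
    unfolding phase_circuit.simps
    by (rule diag_act_cong[OF diag_act_append[OF i(1) diag_act_append[OF i(2) 
              diag_act_CNOT_conj[OF i(3) n(1)]]]])
      (use n upd in \<open>auto simp: of_bool_def\<close>)
qed simp

lemma valid_phase_circuit:
  "distinct qs \<Longrightarrow> set qs \<subseteq> {..<N} \<Longrightarrow> valid_circuit N (phase_circuit \<phi> qs)"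
  by (induction \<phi> qs rule: phase_circuit.induct) auto

text \<open>One more qubit means three recursive calls and two further CNOT gates, so the count plus
  one triples. Truncated subtraction covers the empty list.\<close>

lemma cnot_count_phase_circuit: "cnot_count (phase_circuit \<phi> qs) = 3 ^ (length qs - 1) - 1"
proof (induction \<phi> qs rule: phase_circuit.induct)
  case (3 \<phi> a b qs)
  have "(3 :: nat) ^ length qs \<ge> 1" by simp
  then show ?case using 3 by (simp del: One_nat_def)
qed auto

text \<open>A crude bound is enough: these circuits are applied to boundedly many qubits, so they
  add only a constant to the depth.\<close>

lemma length_phase_circuit: "length (phase_circuit \<phi> qs) \<le> 4 ^ length qs"
proof (induction \<phi> qs rule: phase_circuit.induct)
  case (3 \<phi> a b qs)
  define x where "x = (4 :: nat) ^ length qs"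
  have "1 \<le> x" by (simp add: x_def)
  with 3 show ?case by (simp flip: x_def)
qed auto

section \<open>Toffoli gates up to phases\<close>

definition hadamard :: "complex mat" where
  "hadamard = mat2 (1 / sqrt 2) (1 / sqrt 2) (1 / sqrt 2) (- (1 / sqrt 2))"

lemma of_real_sqrt2_mult: "complex_of_real (sqrt 2) * complex_of_real (sqrt 2) = 2"
  by (simp flip: of_real_mult)

lemma unitary_hadamard: "unitary_mat 2 hadamard"
  unfolding hadamard_def unitary_mat2_iff by (simp add: of_real_sqrt2_mult)

text \<open>On qubit \<open>q\<close>, conjugating the diagonal matrix with entries x, y by Hadamard
  gates gives (x + y) / 2 times the identity plus (x - y) / 2 times Pauli X.\<close>

lemma act_hadamard_conj:
  assumes "diag_act gs \<phi>"
  shows "act (Single q hadamard # gs @ [Single q hadamard]) \<psi> z =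
    (cis (\<phi> (z(q := False))) + cis (\<phi> (z(q := True)))) / 2 * \<psi> z +
    (cis (\<phi> (z(q := False))) - cis (\<phi> (z(q := True)))) / 2 * \<psi> (z(q := \<not> z q))"
  unfolding act.simps act_append diag_actD[OF assms] hadamard_def
  by (cases "z q") (simp_all add: of_real_sqrt2_mult distrib_left fun_upd_idem right_diff_distrib
      left_diff_distrib distrib_right add_divide_distrib diff_divide_distrib)

lemma gate_act_phase_gate: "gate_act (phase_gate \<phi> q) \<psi> = (\<lambda>z. cis (\<phi> * of_bool (z q)) * \<psi> z)"
  using diag_act_phase_gate[of \<phi> q] by (simp add: diag_act_def)

lemma valid_pauli_X [simp]: "unitary_mat 2 pauli_X"
proof -
  have X: "pauli_X = mat2 0 1 1 0"
    by (rule mat2_eqI) (auto simp: pauli_X_def)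
  show ?thesis unfolding X unitary_mat2_iff by simp
qed

lemma gate_act_pauli_X: "gate_act (Single q pauli_X) \<psi> = (\<lambda>z. \<psi> (z(q := \<not> z q)))"
  by (rule ext) (simp add: pauli_X_def)

fun ccphase_circuit :: "nat \<times> nat \<times> nat \<Rightarrow> circuit" where
  "ccphase_circuit (a, b, c) =
     [phase_gate (pi / 4) c, CNOT b c, phase_gate (- pi / 4) c, CNOT a c,
      phase_gate (pi / 4) c, CNOT b c, phase_gate (- pi / 4) c, CNOT a c]"

text \<open>The phase pi / 4 is collected with signs +, -, +, - on the parities c, c + b, c + a + b,
  c + a. They cancel in pairs unless a and b are both set, when they add up to pi / 2 with the sign
  given by c.\<close>

lemma diag_act_ccphase_circuit:
  assumes "distinct [a, b, c]"
  shows "diag_act (ccphase_circuit (a, b, c))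
    (\<lambda>z. if z a \<and> z b then if z c then pi / 2 else - (pi / 2) else 0)"
  unfolding diag_act_def
proof (intro allI ext)
  fix \<psi> z
  have n: "a \<noteq> b" "a \<noteq> c" "b \<noteq> c" using assms by auto
  have c: "cis (pi / 4) * (cis (pi / 4) * x) = cis (pi / 2) * x"
    "cis (- (pi / 4)) * (cis (- (pi / 4)) * x) = cis (- (pi / 2)) * x"
    "cis (- (pi / 4)) * (cis (pi / 4) * x) = x" "cis (pi / 4) * (cis (- (pi / 4)) * x) = x" for x
    by (simp_all add: mult.assoc[symmetric] cis_mult)
  show "act (ccphase_circuit (a, b, c)) \<psi> z = 
    cis (if z a \<and> z b then if z c then pi / 2 else - (pi / 2) else 0) * \<psi> z"
    using n by (cases "z a"; cases "z b"; cases "z c")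
      (simp_all add: gate_act_phase_gate c fun_upd_idem del: cis_pi_half)
qed

text \<open>A Toffoli gate up to phases, preceded by a flip of the target, so that a target in state
  \<open>|1\<rangle>\<close> receives the conjunction of the controls and the all-ones state is fixed.\<close>

fun move_circuit :: "nat \<times> nat \<times> nat \<Rightarrow> circuit" where
  "move_circuit (a, b, c) =
     Single c pauli_X # Single c hadamard # ccphase_circuit (a, b, c) @ [Single c hadamard]"

fun move :: "nat \<times> nat \<times> nat \<Rightarrow> (nat \<Rightarrow> bool) \<Rightarrow> (nat \<Rightarrow> bool)" where
  "move (a, b, c) z = z(c := (\<not> z c) \<noteq> (z a \<and> z b))"

text \<open>With both controls set, the Hadamard gates turn the phases -i, i into -i times Pauli X,
  which undoes the initial flip up to the factor -i. Otherwise only the flip remains.\<close>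

lemma act_move_circuit:
  assumes "distinct [a, b, c]"
  shows "act (move_circuit (a, b, c)) \<psi> z = (if z a \<and> z b then - \<i> * \<psi> z else \<psi> (z(c := \<not> z c)))"
proof -
  have "act (move_circuit (a, b, c)) \<psi> z = 
    act (Single c hadamard # ccphase_circuit (a, b, c) @ [Single c hadamard]) 
     (\<lambda>z. \<psi> (z(c := \<not> z c))) z"
    by (simp only: move_circuit.simps act.simps append_Cons gate_act_pauli_X)
  also have "\<dots> = (if z a \<and> z b then - \<i> * \<psi> z else \<psi> (z(c := \<not> z c)))"
    unfolding act_hadamard_conj[OF diag_act_ccphase_circuit[OF assms]]
    using assms by (auto simp: fun_upd_idem cis_minus_pi_half field_simps)
  finally show ?thesis .
qed

lemma valid_move_circuit:
  "distinct [a, b, c] \<Longrightarrow> {a, b, c} \<subseteq> {..<N} \<Longrightarrow> valid_circuit N (move_circuit (a, b, c))"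
  by (simp add: unitary_hadamard)

text \<open>The relative phase -i of the move meets the phase i of its inverse, since the diagonal
  circuit in between preserves the basis states. This is why Toffoli gates up to phases
  suffice.\<close>

lemma diag_act_move_conj:
  assumes "diag_act gs \<phi>" and d: "distinct [a, b, c]"
  shows "diag_act (move_circuit (a, b, c) @ gs @ inv_circuit (move_circuit (a, b, c)))
    (\<lambda>z. \<phi> (move (a, b, c) z))"
proof -
  have n: "a \<noteq> c" "b \<noteq> c" using d by auto
  have v: "valid_circuit (Suc (max a (max b c))) (move_circuit (a, b, c))"
    using d by (intro valid_move_circuit) auto
  let ?I = "act (inv_circuit (move_circuit (a, b, c)))"
  have I: "?I \<psi> z = (if z a \<and> z b then \<i> * \<psi> z else \<psi> (z(c := \<not> z c)))" for \<psi> z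
  proof (cases "z a \<and> z b")
    case True
    have "\<psi> z = - \<i> * ?I \<psi> z"
      using act_inv(2)[OF v, of \<psi>] act_move_circuit[OF d, of "?I \<psi>" z] True
      by (simp del: move_circuit.simps)
    then show ?thesis using True by (simp del: move_circuit.simps)
  next
    case False
    \<comment> \<open>The value of the inverse at \<open>z\<close> is read off from the move at the
      flipped assignment, whose controls are not both set either.\<close>
    let ?z = "z(c := \<not> z c)"
    have "\<not> (?z a \<and> ?z b)" using False n by auto
    have "\<psi> ?z = act (move_circuit (a, b, c)) (?I \<psi>) ?z"
      by (simp only: act_inv(2)[OF v])
    also have "\<dots> = ?I \<psi> (?z(c := \<not> ?z c))"
      unfolding act_move_circuit[OF d] by (rule if_not_P) fact
    also have "?z(c := \<not> ?z c) = z" by simp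
    finally have "?I \<psi> z = \<psi> ?z" by (rule sym)
    then show ?thesis using False by (simp only: if_False)
  qed
  have i: "\<i> * (x * (\<i> * y)) = - (x * y)" for x y
    by (metis complex_i_mult_minus mult.left_commute mult_minus_right)
  show ?thesis
    unfolding diag_act_def
  proof (intro allI ext)
    fix \<psi> z
    show "act (move_circuit (a, b, c) @ gs @ inv_circuit (move_circuit (a, b, c))) \<psi> z
      = cis (\<phi> (move (a, b, c) z)) * \<psi> z"
      unfolding act_append I diag_actD[OF assms(1)] act_move_circuit[OF d]
      using n by (auto simp: fun_upd_idem i)
  qed
qed

section \<open>Sequences of moves\<close>

fun move_qubits :: "nat \<times> nat \<times> nat \<Rightarrow> nat set" where
  "move_qubits (a, b, c) = {a, b, c}"

fun move_ok :: "nat \<times> nat \<times> nat \<Rightarrow> bool" where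
  "move_ok (a, b, c) \<longleftrightarrow> distinct [a, b, c]"

definition moves_qubits :: "(nat \<times> nat \<times> nat) list \<Rightarrow> nat set" where
  "moves_qubits ms = (\<Union>m\<in>set ms. move_qubits m)"

lemma moves_qubits_simps [simp]:
  "moves_qubits [] = {}" "moves_qubits (m # ms) = move_qubits m \<union> moves_qubits ms"
  "moves_qubits (ms @ ns) = moves_qubits ms \<union> moves_qubits ns"
  by (auto simp: moves_qubits_def)

definition moves :: "(nat \<times> nat \<times> nat) list \<Rightarrow> (nat \<Rightarrow> bool) \<Rightarrow> (nat \<Rightarrow> bool)" where
  "moves ms = fold move ms"

lemma moves_simps [simp]:
  "moves [] z = z" "moves (m # ms) z = moves ms (move m z)" 
  "moves (ms @ ns) z = moves ns (moves ms z)"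
  by (auto simp: moves_def)

definition moves_circuit :: "(nat \<times> nat \<times> nat) list \<Rightarrow> circuit" where
  "moves_circuit ms = concat (map move_circuit ms)"

lemma moves_circuit_simps [simp]:
  "moves_circuit [] = []" "moves_circuit (m # ms) = move_circuit m @ moves_circuit ms"
  "moves_circuit (ms @ ns) = moves_circuit ms @ moves_circuit ns"
  by (auto simp: moves_circuit_def)

lemma diag_act_moves_conj:
  "diag_act gs \<phi> \<Longrightarrow> \<forall>m\<in>set ms. move_ok m \<Longrightarrow>
    diag_act (moves_circuit ms @ gs @ inv_circuit (moves_circuit ms)) (\<lambda>z. \<phi> (moves ms z))"
proof (induction ms)
  case (Cons m ms)
  obtain a b c where m: "m = (a, b, c)" by (cases m)
  have "diag_act (moves_circuit ms @ gs @ inv_circuit (moves_circuit ms)) (\<lambda>z. \<phi> (moves ms z))"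
    using Cons by simp
  from diag_act_move_conj[OF this, of a b c] show ?case
    using Cons.prems by (simp add: m del: move.simps move_circuit.simps)
qed simp

lemma valid_moves_circuit:
  "\<forall>m\<in>set ms. move_ok m \<Longrightarrow> moves_qubits ms \<subseteq> {..<N} \<Longrightarrow> valid_circuit N (moves_circuit ms)"
proof (induction ms)
  case (Cons m ms)
  then show ?case
    using valid_move_circuit[of _ _ _ N] by (cases m) (auto simp del: move_circuit.simps)
qed simp

lemma circuit_qubits_move_circuit: "circuit_qubits (move_circuit m) = move_qubits m"
  by (cases m) auto

lemma circuit_qubits_moves_circuit: "circuit_qubits (moves_circuit ms) = moves_qubits ms"
  by (induction ms) (auto simp: circuit_qubits_move_circuit)

lemma cnot_count_moves_circuit: "cnot_count (moves_circuit ms) = 4 * length ms"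
proof (induction ms)
  case (Cons m ms)
  then show ?case by (cases m) (simp add: phase_gate_def)
qed simp

lemma length_moves_circuit: "length (moves_circuit ms) = 11 * length ms"
proof (induction ms)
  case (Cons m ms)
  then show ?case by (cases m) simp
qed simp

lemma moves_frame: "q \<notin> moves_qubits ms \<Longrightarrow> moves ms z q = z q"
proof (induction ms arbitrary: z)
  case (Cons m ms)
  then show ?case by (cases m) simp
qed simp

text \<open>In the soundness proofs, this shows that a subtree whose qubits have been certified as
  set has changed nothing.\<close>

lemma moves_ones: "\<forall>q\<in>moves_qubits ms. z q \<Longrightarrow> moves ms z = z"
proof (induction ms arbitrary: z)
  case (Cons m ms)
  then show ?case by (cases m) (auto simp: fun_upd_idem)
qed simp

section \<open>Conjunctions in place\<close>

text \<open>If \<open>p\<close> and \<open>q\<close> are set, \<open>q\<close> stays set exactly if all of \<open>ys\<close> are set. Once \<open>p\<close>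
  has received the conjunction of two qubits, these two may be assumed to be set: otherwise
  \<open>p\<close> is cleared and so is, in the end, \<open>q\<close>. They are thus reused as workspace for the rest.\<close>

fun ladder :: "nat \<Rightarrow> nat \<Rightarrow> nat list \<Rightarrow> (nat \<times> nat \<times> nat) list" where
  "ladder p q [] = []"
| "ladder p q [y] = [(p, y, q)]"
| "ladder p q (y # y' # ys) = (y, y', p) # ladder y y' ys @ [(p, y', q)]"

lemma ladder_qubits: "moves_qubits (ladder p q ys) \<subseteq> insert p (insert q (set ys))"
  by (induction p q ys rule: ladder.induct) auto

lemma ladder_ok: "distinct (p # q # ys) \<Longrightarrow> \<forall>m\<in>set (ladder p q ys). move_ok m"
  by (induction p q ys rule: ladder.induct) auto

lemma length_ladder: "length (ladder p q ys) = length ys"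
  by (induction p q ys rule: ladder.induct) auto

text \<open>The argument runs backwards. As \<open>q\<close> starts set, its final value forces both
  controls of the last move to be set. Then \<open>p\<close> certifies \<open>y\<close> and
  \<open>y'\<close>, which supplies the premises for the inner ladder, and \<open>y'\<close>
  certifies the rest.\<close>

lemma ladder_sound:
  "distinct (p # q # ys) \<Longrightarrow> z p \<Longrightarrow> z q \<Longrightarrow> moves (ladder p q ys) z q \<Longrightarrow> \<forall>y\<in>set ys. z y"
proof (induction p q ys arbitrary: z rule: ladder.induct)
  case (3 p q y y' ys)
  define z1 where "z1 = move (y, y', p) z"
  define z2 where "z2 = moves (ladder y y' ys) z1"
  have fr: "z2 p = z1 p" "z2 q = z1 q"
    unfolding z2_def using "3.prems"(1) ladder_qubits[of y y' ys] by (auto intro!: moves_frame)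
  have "moves (ladder p q (y # y' # ys)) z q \<longleftrightarrow> (\<not> z2 q) \<noteq> (z2 p \<and> z2 y')"
    by (simp add: z1_def z2_def)
  moreover have "z1 q = z q" using "3.prems"(1) by (auto simp: z1_def)
  ultimately have "z2 p" "z2 y'" using "3.prems" fr by auto
  then have y: "z y" "z y'" using fr "3.prems" by (auto simp: z1_def)
  then have "z1 y" "z1 y'" using "3.prems"(1) by (auto simp: z1_def)
  with \<open>z2 y'\<close> have "\<forall>x\<in>set ys. z1 x"
    using "3.IH"[of z1] "3.prems"(1) unfolding z2_def by simp
  then show ?case using y "3.prems"(1) by (auto simp: z1_def)
qed auto

text \<open>The output is in \<open>r\<close>. Six qubits are consumed per node because each of the
  two children needs three set qubits of its own. The ladder certifies these six in
  \<open>q\<close>; the children report to \<open>ys ! 2\<close> and \<open>ys ! 5\<close>, and the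
  last two moves combine both reports with \<open>q\<close>.\<close>

function tree :: "nat \<Rightarrow> nat \<Rightarrow> nat \<Rightarrow> nat list \<Rightarrow> (nat \<times> nat \<times> nat) list" where
  "tree p q r ys = (if length ys < 6 then ladder p r ys
     else let h = (length ys - 6) div 2 in
       ladder p q (take 6 ys) @
       tree (ys ! 0) (ys ! 1) (ys ! 2) (take h (drop 6 ys)) @
       tree (ys ! 3) (ys ! 4) (ys ! 5) (drop h (drop 6 ys)) @
       [(ys ! 2, ys ! 5, p), (q, p, r)])"
  by pat_completeness auto
termination by (relation "Wellfounded.measure (\<lambda>(p, q, r, ys). length ys)") auto

declare tree.simps [simp del]

lemma length_ge_6E:
  assumes "\<not> length ys < 6"
  obtains a b c d e f zs where "ys = a # b # c # d # e # f # zs"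
proof -
  have "Suc (Suc (Suc (Suc (Suc (Suc 0))))) \<le> length ys" using assms by simp
  then show ?thesis using that by (auto simp: Suc_le_length_iff)
qed

lemma tree_short: "length ys < 6 \<Longrightarrow> tree p q r ys = ladder p r ys"
  by (simp add: tree.simps)

text \<open>The recursion in explicit list form. The two length premises record that the halves are
  balanced, as needed for the depth.\<close>

lemma tree_induct [case_names short long]:
  assumes "\<And>p q r ys. length ys < 6 \<Longrightarrow> P p q r ys"
    and "\<And>p q r a b c d e f xs ys. P a b c xs \<Longrightarrow> P d e f ys \<Longrightarrow> length xs \<le> length ys \<Longrightarrow>
      length ys \<le> Suc (length xs) \<Longrightarrow>
      tree p q r (a # b # c # d # e # f # xs @ ys) = ladder p q [a, b, c, d, e, f] @ tree a b c xs @
        tree d e f ys @ [(c, f, p), (q, p, r)] \<Longrightarrow> P p q r (a # b # c # d # e # f # xs @ ys)"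
  shows "P p q r ys"
proof (induction "length ys" arbitrary: p q r ys rule: less_induct)
  case less
  show ?case
  proof (cases "length ys < 6")
    case True
    then show ?thesis by (rule assms(1))
  next
    case False
    then obtain a b c d e f zs where ys: "ys = a # b # c # d # e # f # zs"
      by (rule length_ge_6E)
    define h where "h = length zs div 2"
    have "P p q r (a # b # c # d # e # f # take h zs @ drop h zs)"
      by (rule assms(2)) (use less ys in \<open>auto simp: h_def tree.simps[of p q r] Let_def\<close>)
    then show ?thesis by (simp add: ys)
  qed
qed

lemma tree_qubits: "moves_qubits (tree p q r ys) \<subseteq> {p, q, r} \<union> set ys"
proof (induction p q r ys rule: tree_induct)
  case (short p q r ys)
  then show ?case using ladder_qubits[of p r ys] by (auto simp: tree_short)
next
  case (long p q r a b c d e f xs ys)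
  then show ?case using ladder_qubits[of p q "[a, b, c, d, e, f]"]
    by (auto simp del: ladder.simps)
qed

lemma tree_ok: "distinct (p # q # r # ys) \<Longrightarrow> \<forall>m\<in>set (tree p q r ys). move_ok m"
proof (induction p q r ys rule: tree_induct)
  case (short p q r ys)
  then show ?case using ladder_ok[of p r ys] by (auto simp: tree_short)
next
  case (long p q r a b c d e f xs ys)
  then show ?case using ladder_ok[of p q "[a, b, c, d, e, f]"]
    by (auto simp del: ladder.simps)
qed

text \<open>A node spends 6 + 2 moves on six qubits, a ladder one move per qubit.\<close>

lemma length_tree: "3 * length (tree p q r ys) \<le> 4 * length ys"
proof (induction p q r ys rule: tree_induct)
  case (short p q r ys)
  then show ?case by (simp add: tree_short length_ladder)
next
  case (long p q r a b c d e f xs ys)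
  show ?case
    unfolding long.hyps(3) using long.IH by (simp add: length_ladder del: ladder.simps)
qed

text \<open>A set output \<open>r\<close> forces \<open>q\<close> to be set, which certifies the
  first six qubits. Hence the ladder changed nothing and \<open>p\<close> was still set, so its last
  move forces the reports \<open>c\<close> and \<open>f\<close> to be set. The first child then
  certifies \<open>xs\<close> and has changed nothing either, so the second child started from
  \<open>z\<close> and certifies \<open>ys\<close>.\<close>

lemma tree_sound:
  "distinct (p # q # r # ys) \<Longrightarrow> z p \<Longrightarrow> z q \<Longrightarrow> z r \<Longrightarrow> moves (tree p q r ys) z r \<Longrightarrow> \<forall>y\<in>set ys. z y"
proof (induction p q r ys arbitrary: z rule: tree_induct)
  case (short p q r ys)
  then show ?case using ladder_sound[of p r ys z] by (simp add: tree_short)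
next
  case (long p q r a b c d e f xs ys)
  note dist = long.prems(1)
  let ?L = "ladder p q [a, b, c, d, e, f]"
  define z1 where "z1 = moves ?L z"
  define z2 where "z2 = moves (tree a b c xs) z1"
  define z3 where "z3 = moves (tree d e f ys) z2"
  note sub = ladder_qubits[of p q "[a, b, c, d, e, f]"] tree_qubits[of a b c xs] tree_qubits[of d e f ys]
  have fr1: "z1 r = z r"
    unfolding z1_def using dist sub(1) by (intro moves_frame) (auto simp del: ladder.simps)
  have fr2: "z2 x = z1 x" if "x \<in> {p, q, r, d, e, f} \<union> set ys" for x
    unfolding z2_def using dist sub(2) that by (intro moves_frame) auto
  have fr3: "z3 x = z2 x" if "x \<in> {p, q, r, a, b, c} \<union> set xs" for x
    unfolding z3_def using dist sub(3) that by (intro moves_frame) auto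
  have ne: "p \<noteq> q" "p \<noteq> r" "q \<noteq> r" using dist by auto
  have "moves (tree p q r (a # b # c # d # e # f # xs @ ys)) z = 
      move (q, p, r) (move (c, f, p) z3)"
    by (simp add: long.hyps(3) z1_def z2_def z3_def del: ladder.simps)
  then have "(\<not> z3 r) \<noteq> (z3 q \<and> (\<not> z3 p) \<noteq> (z3 c \<and> z3 f))"
    using long.prems(5) ne by simp
  moreover have "z3 r" using fr1 fr2 fr3 long.prems(4) by simp
  ultimately have q: "z3 q" and p: "(\<not> z3 p) \<noteq> (z3 c \<and> z3 f)" by auto
  have "moves ?L z q" using q fr2 fr3 by (simp add: z1_def del: ladder.simps)
  moreover have "distinct (p # q # [a, b, c, d, e, f])" using dist by simp
  ultimately have six: "\<forall>y\<in>set [a, b, c, d, e, f]. z y"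
    using ladder_sound long.prems(2,3) by blast
  then have z1: "z1 = z"
    unfolding z1_def using sub(1) long.prems(2,3) six by (intro moves_ones) blast
  have "z3 p" using fr2 fr3 z1 long.prems(2) by simp
  then have cf: "z3 c" "z3 f" using p by auto
  have xs: "\<forall>y\<in>set xs. z y"
    using long.IH(1)[of z] cf(1) fr3[of c] z1 six dist unfolding z2_def by simp
  have z2: "z2 = z"
    unfolding z2_def z1 using sub(2) six xs by (intro moves_ones) auto
  have "\<forall>y\<in>set ys. z y"
    using long.IH(2)[of z] cf(2) z2 six dist unfolding z3_def by simp
  then show ?case using six xs by auto
qed

lemma tree_iff:
  assumes "distinct (p # q # r # ys)" "z p" "z q" "z r"
  shows "moves (tree p q r ys) z r \<longleftrightarrow> (\<forall>y\<in>set ys. z y)"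
proof
  assume "\<forall>y\<in>set ys. z y"
  then have "moves (tree p q r ys) z = z"
    using assms tree_qubits[of p q r ys] by (intro moves_ones) auto
  then show "moves (tree p q r ys) z r" using assms by simp
qed (use tree_sound[OF assms] in simp)

text \<open>Each level costs 8 moves of 11 gates, that is 88, while the children act on disjoint
  qubits and at most half of the list.\<close>

lemma depth_tree:
  "distinct (p # q # r # ys) \<Longrightarrow> length ys < 2 ^ d \<Longrightarrow>
    depth (moves_circuit (tree p q r ys)) \<le> 88 * (d + 1)"
proof (induction p q r ys arbitrary: d rule: tree_induct)
  case (short p q r ys)
  have "depth (moves_circuit (tree p q r ys)) \<le> 11 * length ys"
    using depth_le_length[of "moves_circuit (tree p q r ys)"] short(1)
    by (simp add: tree_short length_moves_circuit length_ladder)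
  then show ?case using short(1) by simp
next
  case (long p q r a b c d' e f xs ys)
  from long.prems(2) have "d \<noteq> 0" by (intro notI) simp
  then obtain k where k: "d = Suc k" by (cases d) auto
  let ?A = "moves_circuit (ladder p q [a, b, c, d', e, f])" and ?B = "moves_circuit (tree a b c xs)"
    and ?C = "moves_circuit (tree d' e f ys)" and ?D = "moves_circuit [(c, f, p), (q, p, r)]"
  have len: "length xs < 2 ^ k" "length ys < 2 ^ k"
    using long.prems(2) long.hyps(1,2) by (auto simp: k)
  have A: "depth ?A \<le> 66"
    using depth_le_length[of ?A] by (simp add: length_moves_circuit length_ladder del: ladder.simps)
  have D: "depth ?D \<le> 22"
    using depth_le_length[of ?D] by (simp only: length_moves_circuit) simp
  have B: "depth ?B \<le> 88 * (k + 1)" and C: "depth ?C \<le> 88 * (k + 1)"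
    using long.IH(1)[OF _ len(1)] long.IH(2)[OF _ len(2)] long.prems(1) by auto
  have BC: "depth (?B @ ?C) \<le> max (depth ?B) (depth ?C)"
    using long.prems(1) tree_qubits[of a b c xs] tree_qubits[of d' e f ys]
    by (intro depth_append_disjoint) (fastforce simp: circuit_qubits_moves_circuit)
  have eq: "moves_circuit (tree p q r (a # b # c # d' # e # f # xs @ ys)) = ?A @ (?B @ ?C) @ ?D"
    unfolding long.hyps(3) by (simp del: ladder.simps)
  have "depth (moves_circuit (tree p q r (a # b # c # d' # e # f # xs @ ys))) 
    \<le> depth ?A + (depth (?B @ ?C) + depth ?D)"
    unfolding eq using depth_append[of ?A "(?B @ ?C) @ ?D"] depth_append[of "?B @ ?C" ?D] by linarith
  also have "\<dots> \<le> 88 * (d + 1)"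
    using A B C BC D by (simp add: k)
  finally show ?case .
qed

section \<open>Controlled increments\<close>

text \<open>The carry into bit \<open>l\<close> when the conjunction of the seeds is added to the
  counter.\<close>

definition carry :: "nat list \<Rightarrow> nat \<Rightarrow> (nat \<Rightarrow> bool) \<Rightarrow> bool" where
  "carry S l z \<longleftrightarrow> (\<forall>s\<in>set S. z s) \<and> (\<forall>j<l. z j)"

text \<open>Every carry is read off the original assignment, so no updated bit enters the
  computation of another.\<close>

fun incr :: "nat list \<Rightarrow> nat \<Rightarrow> (nat \<Rightarrow> bool) \<Rightarrow> (nat \<Rightarrow> bool)" where
  "incr S 0 z = z"
| "incr S (Suc l) z = (incr S l z)(l := (z l \<noteq> carry S l z))"

definition counter :: "nat \<Rightarrow> (nat \<Rightarrow> bool) \<Rightarrow> real" where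
  "counter l z = (\<Sum>j<l. of_bool (z j) * 2 ^ j)"

lemma incr_frame: "l \<le> q \<Longrightarrow> incr S l z q = z q"
  by (induction l) auto

lemma incr_upd: "l \<le> q \<Longrightarrow> q \<notin> set S \<Longrightarrow> incr S l (z(q := v)) = (incr S l z)(q := v)"
proof (induction l)
  case (Suc l)
  have q: "l \<noteq> q" "l \<le> q" using Suc.prems by auto
  have "carry S l (z(q := v)) = carry S l z"
    using Suc.prems by (auto simp: carry_def)
  then show ?case
    unfolding incr.simps Suc.IH[OF q(2) Suc.prems(2)] fun_upd_other[OF q(1)] 
    by (simp only: fun_upd_twist[OF q(1)])
qed simp

lemma incr_id: "\<not> (\<forall>s\<in>set S. z s) \<Longrightarrow> incr S l z = z"
  by (induction l) (auto simp: carry_def fun_upd_idem)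

text \<open>A carry into bit \<open>l\<close> either sets this bit or, if it is set, clears it and
  passes on. The overflow term is the source of the wanted phase.\<close>

lemma counter_incr:
  "counter l (incr S l z) = counter l z + of_bool (\<forall>s\<in>set S. z s) - 2 ^ l * of_bool (carry S l z)"
proof (induction l)
  case (Suc l)
  have "counter (Suc l) (incr S (Suc l) z) = counter l (incr S l z) + of_bool (z l \<noteq> carry S l z) * 2 ^ l"
    by (simp add: counter_def)
  moreover have "carry S (Suc l) z \<longleftrightarrow> carry S l z \<and> z l"
    by (auto simp: carry_def less_Suc_eq)
  ultimately show ?case
    using Suc by (auto simp: counter_def)
qed (simp add: counter_def carry_def)

definition counter_phase :: "real \<Rightarrow> nat \<Rightarrow> nat list \<Rightarrow> circuit" where
  "counter_phase \<theta> l Q = concat (map (\<lambda>j. phase_circuit (\<theta> * 2 ^ j) (j # Q)) [0..<l])"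

lemma counter_phase_Suc:
  "counter_phase \<theta> (Suc l) Q = counter_phase \<theta> l Q @ phase_circuit (\<theta> * 2 ^ l) (l # Q)"
  by (simp add: counter_phase_def)

lemma counter_phase_0 [simp]: "counter_phase \<theta> 0 Q = []"
  by (simp add: counter_phase_def)

lemma diag_act_counter_phase:
  assumes "distinct Q" "\<forall>q\<in>set Q. l \<le> q"
  shows "diag_act (counter_phase \<theta> l Q) (\<lambda>z. \<theta> * counter l z * of_bool (\<forall>q\<in>set Q. z q))"
  using assms(2)
proof (induction l)
  case (Suc l)
  have "l \<notin> set Q" using Suc.prems by force
  then have "diag_act (phase_circuit (\<theta> * 2 ^ l) (l # Q))
      (\<lambda>z. \<theta> * 2 ^ l * of_bool (\<forall>q\<in>set (l # Q). z q))"
    using assms(1) by (intro diag_act_phase_circuit) auto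
  moreover have "diag_act (counter_phase \<theta> l Q) (\<lambda>z. \<theta> * counter l z * of_bool (\<forall>q\<in>set Q. z q))"
    using Suc by force
  ultimately show ?case
    unfolding counter_phase_Suc
    by (rule diag_act_cong[OF diag_act_append[rotated]]) (simp add: counter_def of_bool_conj algebra_simps)
qed (simp add: counter_def diag_act_Nil)

lemma valid_counter_phase:
  assumes "distinct Q" "\<forall>q\<in>set Q. l \<le> q \<and> q < N" "l \<le> N"
  shows "valid_circuit N (counter_phase \<theta> l Q)"
  using assms(2,3)
proof (induction l)
  case (Suc l)
  have "l \<notin> set Q" using Suc.prems by force
  then have "valid_circuit N (phase_circuit (\<theta> * 2 ^ l) (l # Q))"
    using Suc.prems assms(1) by (intro valid_phase_circuit) auto
  then show ?case using Suc unfolding counter_phase_Suc by fastforce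
qed simp

lemma cnot_count_counter_phase: "cnot_count (counter_phase \<theta> l Q) = l * (3 ^ length Q - 1)"
  by (induction l) (auto simp: counter_phase_Suc cnot_count_phase_circuit)

lemma length_counter_phase: "length (counter_phase \<theta> l Q) \<le> l * (4 * 4 ^ length Q)"
proof (induction l)
  case (Suc l)
  then show ?case
    using length_phase_circuit[of "\<theta> * 2 ^ l" "l # Q"] by (simp add: counter_phase_Suc)
qed simp

text \<open>Conjugating the phases of the bit \<open>l\<close> by the decrement of the lower bits leaves the sign
  \<open>(- 1)\<^bsup>z l * carry\<^esup>\<close>, since the lower bits change by the seed minus \<open>2 ^ l * carry\<close>;
  Hadamard gates turn this sign into a flip. This is a Fourier adder, unrolled.\<close>

fun decrement :: "nat list \<Rightarrow> nat \<Rightarrow> circuit" where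
  "decrement S 0 = []"
| "decrement S (Suc l) = Single l hadamard # counter_phase (- (pi / 2 ^ l)) l [l] @ decrement S l @
     counter_phase (pi / 2 ^ l) l [l] @ phase_circuit (pi / 2 ^ l) (S @ [l]) @ [Single l hadamard]"

text \<open>Amplitudes are pulled back: if basis states are decremented, the new amplitude at
  \<open>z\<close> is the old one at the incremented assignment.\<close>

lemma act_decrement:
  assumes S: "distinct S" 
  shows "\<forall>s\<in>set S. l \<le> s \<Longrightarrow> act (decrement S l) \<psi> z = \<psi> (incr S l z)"
proof (induction l arbitrary: \<psi> z)
  case (Suc l)
  have l: "l \<notin> set S" "\<forall>s\<in>set S. l \<le> s" using Suc.prems by force+
  define \<theta> where "\<theta> = pi / 2 ^ l"
  let ?G = "counter_phase (- \<theta>) l [l] @ decrement S l @ counter_phase \<theta> l [l] @ phase_circuit \<theta> (S @ [l])"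
  have P1: "diag_act (counter_phase (- \<theta>) l [l]) (\<lambda>z. - \<theta> * counter l z * of_bool (z l))"
    using diag_act_counter_phase[of "[l]" l "- \<theta>"] by simp
  have P2: "diag_act (counter_phase \<theta> l [l]) (\<lambda>z. \<theta> * counter l z * of_bool (z l))"
    using diag_act_counter_phase[of "[l]" l "\<theta>"] by simp
  have P3: "diag_act (phase_circuit \<theta> (S @ [l])) (\<lambda>z. \<theta> * of_bool (\<forall>q\<in>set (S @ [l]). z q))"
    using S l by (intro diag_act_phase_circuit) auto
  have G: "act ?G \<psi> z = (if carry S l z \<and> z l then - 1 else 1) * \<psi> (incr S l z)" for \<psi> z
  proof -
    let ?c = "if carry S l z \<and> z l then - 1 else (1 :: complex)"
    have "act ?G \<psi> z = cis (\<theta> * of_bool (\<forall>q\<in>set (S @ [l]). z q)) * (cis (\<theta> * counter l z * of_bool (z l)) *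
        (cis (- \<theta> * counter l (incr S l z) * of_bool (z l)) * \<psi> (incr S l z)))"
      unfolding act_append diag_actD[OF P3] diag_actD[OF P2] Suc.IH[OF l(2)] diag_actD[OF P1]
      by (simp add: incr_frame)
    \<comment> \<open>On a set bit \<open>l\<close> the two counter phases leave
      \<open>\<theta>\<close> times (\<open>2 ^ l\<close> carry minus seed), and the last phase
      circuit cancels the seed term. The rest is pi times the carry.\<close>
    also have "\<dots> = cis (\<theta> * 2 ^ l * of_bool (carry S l z \<and> z l)) * \<psi> (incr S l z)"
      unfolding mult.assoc[symmetric] cis_mult counter_incr
      by (simp add: of_bool_conj algebra_simps)
    also have "cis (\<theta> * 2 ^ l * of_bool (carry S l z \<and> z l)) = ?c"
      by (simp add: \<theta>_def)
    finally show ?thesis .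
  qed
  have c: "carry S l (z(l := v)) = carry S l z" for v
    using l by (auto simp: carry_def)
  have "act (decrement S (Suc l)) \<psi> z = 
     act [Single l hadamard] (act ?G (act [Single l hadamard] \<psi>)) z"
    by (simp add: \<theta>_def)
  also have "\<dots> = \<psi> (incr S (Suc l) z)"
    unfolding act.simps gate_act.simps G incr_upd[OF order_refl l(1)] c
    by (cases "z l"; cases "carry S l z") 
      (simp_all add: hadamard_def of_real_sqrt2_mult incr_frame divide_simps fun_upd_idem)
  finally show ?case .
qed simp

lemma valid_decrement:
  assumes "distinct S"
  shows "\<forall>s\<in>set S. l \<le> s \<and> s < N \<Longrightarrow> l \<le> N \<Longrightarrow> valid_circuit N (decrement S l)"
proof (induction l)
  case (Suc l)
  have "l \<notin> set S" using Suc.prems by force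
  then have "valid_circuit N (phase_circuit (pi / 2 ^ l) (S @ [l]))"
    using Suc.prems assms by (intro valid_phase_circuit) auto
  moreover have "valid_circuit N (counter_phase \<theta> l [l])" for \<theta>
    using Suc.prems by (intro valid_counter_phase) auto
  moreover have "valid_circuit N (decrement S l)"
    using Suc by (auto simp: Suc_le_eq less_imp_le)
  ultimately show ?case
    using Suc.prems by (simp add: unitary_hadamard)
qed simp

text \<open>Bit \<open>l\<close> costs \<open>2 * l\<close> CNOT gates for each of the two counter
  phases and \<open>3 ^ length S - 1\<close> for the seed phase.\<close>

lemma cnot_count_decrement:
  "int (cnot_count (decrement S l)) = 2 * int l * (int l - 1) + int l * (3 ^ length S - 1)"
proof (induction l)
  case (Suc l)
  obtain x where x: "(3 :: nat) ^ length S = Suc x"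
    using not0_implies_Suc[of "(3 :: nat) ^ length S"] by auto
  have "int (cnot_count (decrement S (Suc l))) = int (cnot_count (decrement S l)) + 4 * int l + int x"
    by (simp add: cnot_count_counter_phase cnot_count_phase_circuit x)
  moreover have "(3 :: int) ^ length S = int x + 1"
    using arg_cong[OF x, of int] by simp
  ultimately show ?case using Suc by (simp add: algebra_simps)
qed simp

lemma length_decrement: "length (decrement S l) \<le> l * (2 + 32 * l + 4 * 4 ^ length S)"
proof (induction l)
  case (Suc l)
  have "length (counter_phase \<theta> l [l]) \<le> 16 * l" for \<theta>
    using length_counter_phase[of \<theta> l "[l]"] by simp
  from this[of "- (pi / 2 ^ l)"] this[of "pi / 2 ^ l"]
  have "length (decrement S (Suc l)) \<le> l * (2 + 32 * l + 4 * 4 ^ length S) + (2 + 32 * l + 4 * 4 ^ length S)"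
    using length_phase_circuit[of "pi / 2 ^ l" "S @ [l]"] Suc by simp
  then show ?case by (simp add: algebra_simps)
qed simp

section \<open>The commutator\<close>

text \<open>Qubits below \<open>m\<close> form the counter, \<open>m\<close>, \<open>m + 1\<close>,
  \<open>m + 2\<close> are the seeds and roots of the tree, and \<open>n\<close> is the target. The
  tree reports to \<open>m + 2\<close>. A set target raises the rate from \<open>\<alpha>\<close> to
  \<open>\<beta>\<close>, whence the difference in the second phase.\<close>

definition conj_phase :: "nat \<Rightarrow> nat \<Rightarrow> real \<Rightarrow> real \<Rightarrow> circuit" where
  "conj_phase m n \<alpha> \<beta> =
     (let L = moves_circuit (tree m (m + 1) (m + 2) [m + 3..<n]) in
      L @ (counter_phase (\<alpha> / 2 ^ m) m [m + 2] @ counter_phase ((\<beta> - \<alpha>) / 2 ^ m) m [m + 2, n]) @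
      inv_circuit L)"

definition core :: "nat \<Rightarrow> nat \<Rightarrow> real \<Rightarrow> real \<Rightarrow> circuit" where
  "core m n \<alpha> \<beta> = conj_phase m n \<alpha> \<beta> @ inv_circuit (decrement [m, m + 1, m + 2] m) @
     inv_circuit (conj_phase m n \<alpha> \<beta>) @ decrement [m, m + 1, m + 2] m"

context
  fixes m n :: nat
  assumes mn: "m + 3 \<le> n"
begin

lemma tree_moves_ok: "\<forall>x\<in>set (tree m (m + 1) (m + 2) [m + 3..<n]). move_ok x"
  by (rule tree_ok) auto

lemma tree_moves_qubits: "moves_qubits (tree m (m + 1) (m + 2) [m + 3..<n]) \<subseteq> {m..<n}"
  using tree_qubits[of m "m + 1" "m + 2" "[m + 3..<n]"] mn by force

lemma valid_tree: "valid_circuit (n + 1) (moves_circuit (tree m (m + 1) (m + 2) [m + 3..<n]))"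
  by (rule valid_moves_circuit[OF tree_moves_ok]) (use tree_moves_qubits in auto)

lemma valid_conj_phase: "valid_circuit (n + 1) (conj_phase m n \<alpha> \<beta>)"
  unfolding conj_phase_def Let_def valid_circuit_simps
  using valid_tree valid_inv_circuit[OF valid_tree] mn
  by (auto intro!: valid_counter_phase)

lemma valid_decrement_seeds: "valid_circuit (n + 1) (decrement [m, m + 1, m + 2] m)"
  using mn by (intro valid_decrement) auto

lemma valid_core: "valid_circuit (n + 1) (core m n \<alpha> \<beta>)"
  unfolding core_def valid_circuit_simps
  using valid_conj_phase valid_decrement_seeds valid_inv_circuit by blast

text \<open>The tree touches neither the counter nor the target. Its output is left unevaluated,
  being the conjunction only when the seeds are set.\<close>

lemma diag_act_conj_phase:
  "diag_act (conj_phase m n \<alpha> \<beta>) (\<lambda>z. (if z n then \<beta> else \<alpha>) / 2 ^ m * counter m z *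
     of_bool (moves (tree m (m + 1) (m + 2) [m + 3..<n]) z (m + 2)))"
proof -
  let ?L = "tree m (m + 1) (m + 2) [m + 3..<n]"
  have fr: "moves ?L z q = z q" if "q < m \<or> n \<le> q" for z q
    using tree_moves_qubits that by (intro moves_frame) auto
  have cnt: "counter m (moves ?L z) = counter m z" for z
    unfolding counter_def by (intro sum.cong refl) (simp only: fr lessThan_iff simp_thms)
  have "diag_act (counter_phase (\<alpha> / 2 ^ m) m [m + 2] @ counter_phase ((\<beta> - \<alpha>) / 2 ^ m) m [m + 2, n])
    (\<lambda>z. \<alpha> / 2 ^ m * counter m z * of_bool (\<forall>q\<in>set [m + 2]. z q) +
         (\<beta> - \<alpha>) / 2 ^ m * counter m z * of_bool (\<forall>q\<in>set [m + 2, n]. z q))"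
    using mn by (intro diag_act_append diag_act_counter_phase) auto
  note conj = diag_act_moves_conj[OF this tree_moves_ok]
  have e: "\<alpha> / 2 ^ m * counter m w * of_bool (\<forall>q\<in>set [m + 2]. w q) +
      (\<beta> - \<alpha>) / 2 ^ m * counter m w * of_bool (\<forall>q\<in>set [m + 2, n]. w q) =
      (if z n then \<beta> else \<alpha>) / 2 ^ m * counter m z * of_bool (w (m + 2))"
    if "counter m w = counter m z" "w n = z n" for w z
    using that by (auto simp: field_simps)
  from conj
  show ?thesis
    unfolding conj_phase_def Let_def
    by (rule diag_act_cong) (rule e[OF cnt fr], simp)
qed

text \<open>The commutator yields the phase at \<open>z\<close> minus the phase at the incremented
  assignment. With an unset seed there is no increment and the difference vanishes, whatever the
  tree computes. With all seeds set, \<open>tree_iff\<close> evaluates the tree and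
  \<open>counter_incr\<close> the difference.\<close>

lemma diag_act_core:
  "diag_act (core m n \<alpha> \<beta>) (\<lambda>z. (if z n then \<beta> else \<alpha>) *
     of_bool (\<forall>q\<in>{m..<n}. z q) * (of_bool (\<forall>q<m. z q) - 1 / 2 ^ m))"
  unfolding diag_act_def
proof (intro allI ext)
  fix \<psi> z
  let ?L = "tree m (m + 1) (m + 2) [m + 3..<n]" and ?S = "[m, m + 1, m + 2]"
  let ?D = "decrement ?S m" and ?A = "conj_phase m n \<alpha> \<beta>"
  define \<phi> where "\<phi> = (\<lambda>z. (if z n then \<beta> else \<alpha>) / 2 ^ m * counter m z * of_bool (moves ?L z (m + 2)))"
  define z' where "z' = incr ?S m z"
  have A: "diag_act ?A \<phi>" unfolding \<phi>_def by (rule diag_act_conj_phase)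
  have D: "act ?D \<psi> z = \<psi> (incr ?S m z)" for \<psi> z
    by (rule act_decrement) auto
  have "act (core m n \<alpha> \<beta>) \<psi> z = 
      act ?D (act (inv_circuit ?A) (act (inv_circuit ?D) (act ?A \<psi>))) z"
    by (simp add: core_def)
  also have "\<dots> = cis (- \<phi> z') * act (inv_circuit ?D) (act ?A \<psi>) z'"
    unfolding D z'_def diag_actD[OF diag_act_inv[OF A valid_conj_phase]] ..
  \<comment> \<open>Evaluating the decrement after its inverse at \<open>z\<close> means evaluating
    the inverse at the incremented assignment.\<close>
  also have "act (inv_circuit ?D) (act ?A \<psi>) z' = act ?A \<psi> z"
    using D[of "act (inv_circuit ?D) (act ?A \<psi>)" z] 
    unfolding z'_def act_inv(2)[OF valid_decrement_seeds] by (rule sym)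
  also have "cis (- \<phi> z') * act ?A \<psi> z = cis (\<phi> z - \<phi> z') * \<psi> z"
    by (simp add: diag_actD[OF A] mult.assoc[symmetric] cis_mult)
  also have "\<phi> z - \<phi> z' = (if z n then \<beta> else \<alpha>) *
     of_bool (\<forall>q\<in>{m..<n}. z q) * (of_bool (\<forall>q<m. z q) - 1 / 2 ^ m)"
  proof (cases "\<forall>s\<in>set ?S. z s")
    case False
    then have "z' = z" unfolding z'_def by (rule incr_id)
    moreover have "\<not> (\<forall>q\<in>{m..<n}. z q)" using False mn by auto
    ultimately show ?thesis by simp
  next
    case True
    have fr: "z' q = z q" if "m \<le> q" for q
      unfolding z'_def using that by (rule incr_frame)
    have out: "moves ?L w (m + 2) \<longleftrightarrow> (\<forall>q\<in>{m..<n}. z q)" if "\<And>q. m \<le> q \<Longrightarrow> w q = z q" for w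
    proof -
      have "moves ?L w (m + 2) \<longleftrightarrow> (\<forall>q\<in>set [m + 3..<n]. w q)"
        using True that by (intro tree_iff) auto
      also have "\<dots> \<longleftrightarrow> (\<forall>q\<in>{m..<n}. z q)"
      proof
        assume *: "\<forall>q\<in>set [m + 3..<n]. w q"
        show "\<forall>q\<in>{m..<n}. z q"
        proof
          fix q assume "q \<in> {m..<n}"
          then have "q \<in> set ?S \<or> q \<in> set [m + 3..<n]" by auto
          then show "z q" using True * that[of q] \<open>q \<in> {m..<n}\<close> by auto
        qed
      qed (use that in auto)
      finally show ?thesis .
    qed
    define c where "c = (if z n then \<beta> else \<alpha>)"
    have \<phi>: "\<phi> w = c / 2 ^ m * counter m w * of_bool (\<forall>q\<in>{m..<n}. z q)" if "\<And>q. m \<le> q \<Longrightarrow> w q = z q" for w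
    proof -
      have "w n = z n" using that mn by simp
      then show ?thesis by (simp only: \<phi>_def out[OF that] c_def)
    qed
    have cnt: "counter m z' = counter m z + 1 - 2 ^ m * of_bool (\<forall>q<m. z q)"
      unfolding z'_def counter_incr using True by (simp add: carry_def)
    have "\<phi> z = c / 2 ^ m * counter m z * of_bool (\<forall>q\<in>{m..<n}. z q)"
      "\<phi> z' = c / 2 ^ m * counter m z' * of_bool (\<forall>q\<in>{m..<n}. z q)"
      by (rule \<phi>, simp add: fr)+
    then show ?thesis
      unfolding cnt c_def[symmetric] by (simp add: field_simps)
  qed
  finally show "act (core m n \<alpha> \<beta>) \<psi> z = cis ((if z n then \<beta> else \<alpha>) *
     of_bool (\<forall>q\<in>{m..<n}. z q) * (of_bool (\<forall>q<m. z q) - 1 / 2 ^ m)) * \<psi> z" .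
qed

text \<open>The factor 3 clears the denominator of the bound 4 / 3 on moves per qubit. The tree or
  its inverse occurs four times, with 4 CNOT gates per move.\<close>

lemma cnot_count_core:
  "3 * int (cnot_count (core m n \<alpha> \<beta>)) \<le> 12 * int m * int m + 204 * int m + 64 * (int n - int m - 3)"
proof -
  let ?L = "tree m (m + 1) (m + 2) [m + 3..<n]"
  have L: "3 * length ?L \<le> 4 * (n - (m + 3))"
    using length_tree[of m "m + 1" "m + 2" "[m + 3..<n]"] by simp
  have "cnot_count (conj_phase m n \<alpha> \<beta>) = 8 * length ?L + 10 * m"
    by (simp add: conj_phase_def Let_def cnot_count_moves_circuit cnot_count_counter_phase)
  moreover have "int (cnot_count (decrement [m, m + 1, m + 2] m)) = 2 * int m * (int m - 1) + 26 * int m"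
    by (simp add: cnot_count_decrement)
  ultimately have "int (cnot_count (core m n \<alpha> \<beta>)) = 16 * int (length ?L) + 20 * int m + 
      2 * (2 * int m * (int m - 1) + 26 * int m)"
    by (simp add: core_def)
  moreover have "3 * int (length ?L) \<le> 4 * (int n - int m - 3)"
  proof -
    have eq: "int (n - (m + 3)) = int n - int m - 3" using mn by (simp add: of_nat_diff)
    have "int (3 * length ?L) \<le> int (4 * (n - (m + 3)))" using L by (simp only: of_nat_le_iff)
    then show ?thesis by (simp only: of_nat_mult of_nat_numeral eq)
  qed
  ultimately show ?thesis by (simp add: algebra_simps)
qed

text \<open>Only the four runs of the tree depend on \<open>n\<close>; they give 352 = 4 * 88. All
  other parts are bounded by their number of gates.\<close>

lemma depth_core:
  assumes "n < 2 ^ d"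
  shows "depth (core m n \<alpha> \<beta>) \<le> 352 * (d + 1) + 
    2 * (m * 64 + m * 256 + m * (2 + 32 * m + 256)) "
proof -
  let ?L = "moves_circuit (tree m (m + 1) (m + 2) [m + 3..<n])" and ?D = "decrement [m, m + 1, m + 2] m"
    and ?P = "counter_phase (\<alpha> / 2 ^ m) m [m + 2]" and ?Q = "counter_phase ((\<beta> - \<alpha>) / 2 ^ m) m [m + 2, n]"
    and ?A = "conj_phase m n \<alpha> \<beta>"
  have L: "depth ?L \<le> 88 * (d + 1)"
    using assms by (intro depth_tree) auto
  have P: "length ?P \<le> m * 64" and Q: "length ?Q \<le> m * 256" and D: "length ?D \<le> m * (2 + 32 * m + 256)"
    using length_counter_phase[of "\<alpha> / 2 ^ m" m "[m + 2]"] 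
      length_counter_phase[of "(\<beta> - \<alpha>) / 2 ^ m" m "[m + 2, n]"]
      length_decrement[of "[m, m + 1, m + 2]" m] by simp_all
  have PQ: "depth (?P @ ?Q) \<le> m * 64 + m * 256"
    using depth_le_length[of "?P @ ?Q"] P Q by simp
  have "depth ?A \<le> depth ?L + (depth (?P @ ?Q) + depth (inv_circuit ?L))"
    unfolding conj_phase_def Let_def
    using depth_append[of ?L "(?P @ ?Q) @ inv_circuit ?L"] depth_append[of "?P @ ?Q" "inv_circuit ?L"]
    by linarith
  then have A: "depth ?A \<le> 176 * (d + 1) + (m * 64 + m * 256)"
    using L PQ depth_inv[of ?L] by linarith
  have D': "depth ?D \<le> m * (2 + 32 * m + 256)"
    using depth_le_length[of ?D] D by linarith
  have "depth (core m n \<alpha> \<beta>) \<le> depth ?A + (depth (inv_circuit ?D) + (depth (inv_circuit ?A) + depth ?D))"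
    unfolding core_def
    using depth_append[of ?A "inv_circuit ?D @ inv_circuit ?A @ ?D"]
      depth_append[of "inv_circuit ?D" "inv_circuit ?A @ ?D"] depth_append[of "inv_circuit ?A" ?D]
    by linarith
  moreover have "x \<le> 352 * (d + 1) + 2 * (q + e)"
    if "x \<le> a + (c' + (a' + c))" "a \<le> 176 * (d + 1) + q" "c \<le> e" "a' \<le> a" "c' \<le> c" 
    for x a a' c c' q e :: nat
    using that by presburger
  ultimately show ?thesis
    using A D' depth_inv[of ?A] depth_inv[of ?D] by blast
qed

end

section \<open>Diagonalization of the target gate\<close>

text \<open>The quadratic formula solves the characteristic equation. An eigenvector is then read
  off a nonzero off-diagonal entry, or is a basis vector if there is none.\<close>

lemma eigenvector_mat2:
  obtains \<mu> u v :: complex where "a * u + b * v = \<mu> * u" "c * u + d * v = \<mu> * v"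
    "cnj u * u + cnj v * v = 1"
proof -
  define s where "s = csqrt ((a - d)\<^sup>2 + 4 * b * c)"
  define \<mu> where "\<mu> = (a + d + s) / 2"
  have s: "s * s = (a - d)\<^sup>2 + 4 * b * c"
    unfolding s_def using power2_csqrt by (simp only: power2_eq_square)
  have "4 * ((a - \<mu>) * (d - \<mu>)) = (a - d + - s) * (- (a - d) - s)"
    by (simp add: \<mu>_def field_simps)
  also have "\<dots> = s * s - (a - d)\<^sup>2"
    by (simp add: power2_eq_square algebra_simps)
  finally have char: "(a - \<mu>) * (d - \<mu>) = b * c"
    using s by simp
  obtain x y where xy: "a * x + b * y = \<mu> * x" "c * x + d * y = \<mu> * y" "x \<noteq> 0 \<or> y \<noteq> 0"
  proof -
    consider "b \<noteq> 0" | "c \<noteq> 0" | "b = 0" "c = 0" "a = \<mu>" | "b = 0" "c = 0" "d = \<mu>"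
      using char by fastforce
    then show ?thesis
    proof cases
      case 1
      show ?thesis
        by (rule that[of b "\<mu> - a"]) (use char 1 in \<open>auto simp: algebra_simps\<close>)
    next
      case 2
      show ?thesis
        by (rule that[of "\<mu> - d" c]) (use char 2 in \<open>auto simp: algebra_simps\<close>)
    next
      case 3
      then show ?thesis by (intro that[of 1 0]) auto
    next
      case 4
      then show ?thesis by (intro that[of 0 1]) auto
    qed
  qed
  define r where "r = sqrt ((cmod x)\<^sup>2 + (cmod y)\<^sup>2)"
  have "(cmod x)\<^sup>2 + (cmod y)\<^sup>2 > 0"
    using xy(3) by (auto intro: add_pos_nonneg add_nonneg_pos)
  then have r: "r > 0" "r * r = (cmod x)\<^sup>2 + (cmod y)\<^sup>2"
    by (auto simp: r_def)
  show ?thesis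
  proof (rule that[of "x / r" "y / r" \<mu>])
    show "a * (x / r) + b * (y / r) = \<mu> * (x / r)" "c * (x / r) + d * (y / r) = \<mu> * (y / r)"
      using xy(1,2) by (simp_all add: add_divide_distrib[symmetric])
    have "cnj x * x + cnj y * y = complex_of_real (r * r)"
      unfolding r(2) of_real_add complex_norm_square by (simp add: mult.commute)
    then show "cnj (x / r) * (x / r) + cnj (y / r) * (y / r) = 1"
      using r(1) by (simp add: add_divide_distrib[symmetric])
  qed
qed

text \<open>A unitary preserves orthogonality, so it maps the orthogonal complement of the
  eigenvector (u, v), spanned by (-cnj v, cnj u), to itself. The formula for \<open>U\<close> is the
  sum of the two projections weighted by the eigenvalues.\<close>

lemma unitary_mat2_diagonalize:
  assumes "unitary_mat 2 U"
  obtains u v :: complex and \<alpha> \<beta> :: real where "cnj u * u + cnj v * v = 1"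
    "\<bar>\<alpha>\<bar> \<le> pi" "\<bar>\<beta>\<bar> \<le> pi"
    "U = mat2 (cis \<alpha> * (u * cnj u) + cis \<beta> * (v * cnj v)) (cis \<alpha> * (u * cnj v) - cis \<beta> * (cnj v * u))
       (cis \<alpha> * (v * cnj u) - cis \<beta> * (cnj u * v)) (cis \<alpha> * (v * cnj v) + cis \<beta> * (u * cnj u))"
proof -
  obtain a b c d where U: "U = mat2 a b c d"
    using assms mat2_eta unfolding unitary_mat_def by blast
  have e: "cnj a * a + cnj c * c = 1" "cnj a * b + cnj c * d = 0"
     "cnj b * a + cnj d * c = 0" "cnj b * b + cnj d * d = 1"
    using assms unfolding U unitary_mat2_iff by auto
  have inner: "cnj (a * x + b * y) * (a * x' + b * y') + cnj (c * x + d * y) * (c * x' + d * y')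
    = cnj x * x' + cnj y * y'" for x y x' y'
  proof -
    have "cnj (a * x + b * y) * (a * x' + b * y') + cnj (c * x + d * y) * (c * x' + d * y')
      = (cnj a * a + cnj c * c) * (cnj x * x') + (cnj a * b + cnj c * d) * (cnj x * y')
        + (cnj b * a + cnj d * c) * (cnj y * x') + (cnj b * b + cnj d * d) * (cnj y * y')"
      by (simp add: algebra_simps)
    then show ?thesis by (simp add: e)
  qed
  obtain A u v where eig: "a * u + b * v = A * u" "c * u + d * v = A * v"
    and n: "cnj u * u + cnj v * v = 1"
    by (rule eigenvector_mat2)
  have "cnj (A * u) * (A * u) + cnj (A * v) * (A * v) = 1"
    using inner[of u v u v] unfolding eig n .
  then have "cnj A * A * (cnj u * u + cnj v * v) = 1"
    by (simp add: algebra_simps)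
  then have A: "cnj A * A = 1" by (simp add: n)
  define p where "p = a * (- cnj v) + b * cnj u"
  define q where "q = c * (- cnj v) + d * cnj u"
  \<comment> \<open>The second eigenvalue: the inner product of (-cnj v, cnj u) with its image (p,
    q).\<close>
  define B where "B = u * q - v * p"
  have "cnj (A * u) * p + cnj (A * v) * q = 0"
    using inner[of u v "- cnj v" "cnj u"] unfolding eig p_def q_def by (simp add: mult.commute)
  then have "A * (cnj A * (cnj u * p + cnj v * q)) = 0"
    by (simp add: algebra_simps)
  then have o: "cnj u * p + cnj v * q = 0"
    using A by (auto simp: mult.assoc[symmetric])
  have pB: "p = - (B * cnj v)"
  proof -
    have "p + B * cnj v = p * (1 - (cnj u * u + cnj v * v)) + u * (cnj u * p + cnj v * q)"
      by (simp add: B_def algebra_simps)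
    then have "p + B * cnj v = 0" by (simp add: n o)
    then show ?thesis by (simp add: eq_neg_iff_add_eq_0)
  qed
  have qB: "q = B * cnj u"
  proof -
    have "q - B * cnj u = q * (1 - (cnj u * u + cnj v * v)) + v * (cnj u * p + cnj v * q)"
      by (simp add: B_def algebra_simps)
    then have "q - B * cnj u = 0" by (simp add: n o)
    then show ?thesis by simp
  qed
  have "cnj p * p + cnj q * q = 1"
    using inner[of "- cnj v" "cnj u" "- cnj v" "cnj u"] n unfolding p_def q_def
    by (simp add: mult.commute add.commute)
  then have "cnj B * B * (cnj u * u + cnj v * v) = 1"
    unfolding pB qB by (simp add: algebra_simps)
  then have B: "cnj B * B = 1" by (simp add: n)
  have cis: "\<exists>\<alpha>. z = cis \<alpha> \<and> \<bar>\<alpha>\<bar> \<le> pi" if "cnj z * z = 1" for z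
  proof -
    have "of_real ((cmod z)\<^sup>2) = (1 :: complex)"
      using that unfolding complex_norm_square by (simp add: mult.commute)
    then have "cmod z = 1"
      by (metis norm_ge_zero of_real_eq_1_iff power2_eq_1_iff not_one_le_zero neg_0_le_iff_le)
    then have "z = cis (Arg z)"
      using rcis_cmod_Arg[of z] by (simp add: rcis_def)
    then show ?thesis using Arg_bounded[of z] by (intro exI[of _ "Arg z"]) auto
  qed
  obtain \<alpha> \<beta> where ab: "A = cis \<alpha>" "\<bar>\<alpha>\<bar> \<le> pi" "B = cis \<beta>" "\<bar>\<beta>\<bar> \<le> pi"
    using cis[OF A] cis[OF B] by blast
  \<comment> \<open>Recovers a row of the matrix from its products with the two orthonormal
    vectors.\<close>
  have entry: "x = cnj u * (x * u + y * v) - v * (x * (- cnj v) + y * cnj u)"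
    "y = cnj v * (x * u + y * v) + u * (x * (- cnj v) + y * cnj u)" for x y
  proof -
    have "cnj u * (x * u + y * v) - v * (x * (- cnj v) + y * cnj u) = x * (cnj u * u + cnj v * v)"
      "cnj v * (x * u + y * v) + u * (x * (- cnj v) + y * cnj u) = y * (cnj u * u + cnj v * v)"
      by (simp_all add: algebra_simps)
    then show "x = cnj u * (x * u + y * v) - v * (x * (- cnj v) + y * cnj u)"
      "y = cnj v * (x * u + y * v) + u * (x * (- cnj v) + y * cnj u)"
      by (simp_all add: n)
  qed
  have "a = A * (u * cnj u) + B * (v * cnj v)"
    using entry(1)[of a b] unfolding p_def[symmetric] pB eig by (simp add: algebra_simps)
  moreover have "b = A * (u * cnj v) - B * (cnj v * u)"
    using entry(2)[of b a] unfolding p_def[symmetric] pB eig by (simp add: algebra_simps)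
  moreover have "c = A * (v * cnj u) - B * (cnj u * v)"
    using entry(1)[of c d] unfolding q_def[symmetric] qB eig by (simp add: algebra_simps)
  moreover have "d = A * (v * cnj v) + B * (u * cnj u)"
    using entry(2)[of d c] unfolding q_def[symmetric] qB eig by (simp add: algebra_simps)
  ultimately show ?thesis
    using that[OF n ab(2,4)] unfolding U ab(1,3) by blast
qed

section \<open>Approximation\<close>

text \<open>The squared distance of \<open>cis \<delta>\<close> from 1 is 2 - 2 cos
  \<open>\<delta>\<close>, and the cosine decreases on [0, pi].\<close>

lemma cmod_cis_minus_one_le:
  assumes "\<bar>\<delta>\<bar> \<le> arccos (1 - \<epsilon>\<^sup>2 / 2)" "0 < \<epsilon>" "\<epsilon> \<le> 2"
  shows "cmod (cis \<delta> - 1) \<le> \<epsilon>"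
proof (rule power2_le_imp_le)
  have "\<epsilon>\<^sup>2 \<le> 2\<^sup>2" using assms by (intro power_mono) auto
  then have b: "- 1 \<le> 1 - \<epsilon>\<^sup>2 / 2" "1 - \<epsilon>\<^sup>2 / 2 \<le> 1" by auto
  have "1 - \<epsilon>\<^sup>2 / 2 = cos (arccos (1 - \<epsilon>\<^sup>2 / 2))" using b by simp
  also have "\<dots> \<le> cos \<bar>\<delta>\<bar>"
    using assms(1) arccos_ubound[OF b] by (intro cos_monotone_0_pi_le) auto
  finally have "1 - \<epsilon>\<^sup>2 / 2 \<le> cos \<delta>" by simp
  moreover have "(cmod (cis \<delta> - 1))\<^sup>2 = 2 - 2 * cos \<delta>"
    using sin_cos_squared_add[of \<delta>] by (simp add: cmod_power2 power2_diff)
  ultimately show "(cmod (cis \<delta> - 1))\<^sup>2 \<le> \<epsilon>\<^sup>2" by simp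
qed (use assms in simp)

text \<open>The columns of \<open>V\<close> are the eigenvectors of \<open>U\<close>, and
  \<open>W\<close> is the adjoint of \<open>V\<close>. Both operators are \<open>V\<close>, a
  diagonal and \<open>W\<close> in turn. As \<open>V\<close> and \<open>W\<close> preserve norms,
  the error is at most the largest distance between diagonal entries.\<close>

lemma spectral_norm_core_le:
  fixes \<alpha> \<beta> :: real and u v :: complex
  defines "V \<equiv> mat2 u (- cnj v) v (cnj u)" and "W \<equiv> mat2 (cnj u) (cnj v) (- v) u"
  assumes n: "cnj u * u + cnj v * v = 1"
    and U: "U = mat2 (cis \<alpha> * (u * cnj u) + cis \<beta> * (v * cnj v)) (cis \<alpha> * (u * cnj v) - cis \<beta> * (cnj v * u))
       (cis \<alpha> * (v * cnj u) - cis \<beta> * (cnj u * v)) (cis \<alpha> * (v * cnj v) + cis \<beta> * (u * cnj u))"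
    and mn: "m + 3 \<le> n" and \<epsilon>: "0 < \<epsilon>" "\<epsilon> \<le> 2"
    and \<alpha>: "\<bar>\<alpha>\<bar> / 2 ^ m \<le> arccos (1 - \<epsilon>\<^sup>2 / 2)" and \<beta>: "\<bar>\<beta>\<bar> / 2 ^ m \<le> arccos (1 - \<epsilon>\<^sup>2 / 2)"
    and circ: "circ = Single n W # core m n \<alpha> \<beta> @ [Single n V]"
  shows "valid_circuit (n + 1) circ"
    and "spectral_norm (circuit_mat (n + 1) circ - CnU n U) \<le> \<epsilon>"
proof -
  have VW: "unitary_mat 2 V" "unitary_mat 2 W"
    unfolding V_def W_def unitary_mat2_iff using n by (simp_all add: algebra_simps)
  then show valid: "valid_circuit (n + 1) circ"
    unfolding circ using valid_core[OF mn] by simp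
  define g where "g = (\<lambda>z :: nat \<Rightarrow> bool. if z n then \<beta> else \<alpha>)"
  define \<chi> where "\<chi> = (\<lambda>z. g z * of_bool (\<forall>q\<in>{..<n}. z q))"
  define \<chi>' where "\<chi>' = (\<lambda>z. g z * of_bool (\<forall>q\<in>{m..<n}. z q) * (of_bool (\<forall>q<m. z q) - 1 / 2 ^ m))"
  have circ_act: "act circ \<psi> = gate_act (Single n V) (\<lambda>z. cis (\<chi>' z) * gate_act (Single n W) \<psi> z)" for \<psi>
    unfolding circ \<chi>'_def g_def act.simps act_append diag_actD[OF diag_act_core[OF mn]] ..
  have ctrl: "(\<forall>q\<in>{..<n}. (z(n := b)) q) \<longleftrightarrow> (\<forall>q\<in>{..<n}. z q)" for z b
    by auto
  have CnU_act: "capply {..<n} n U \<psi> = gate_act (Single n V) (\<lambda>z. cis (\<chi> z) * gate_act (Single n W) \<psi> z)" for \<psi>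
  proof
    fix z
    let ?x = "\<psi> (z(n := False))" and ?y = "\<psi> (z(n := True))"
    show "capply {..<n} n U \<psi> z = gate_act (Single n V) (\<lambda>z. cis (\<chi> z) * gate_act (Single n W) \<psi> z) z"
    proof (cases "\<forall>q\<in>{..<n}. z q")
      case True
      then show ?thesis
        unfolding capply_def gate_act.simps \<chi>_def g_def ctrl
        by (cases "z n") (simp_all add: U V_def W_def algebra_simps)
    next
      case False
      have "u * (cnj u * ?x + cnj v * ?y) + - cnj v * (- v * ?x + u * ?y) = (cnj u * u + cnj v * v) * ?x"
        "v * (cnj u * ?x + cnj v * ?y) + cnj u * (- v * ?x + u * ?y) = (cnj u * u + cnj v * v) * ?y"
        by (simp_all add: algebra_simps)
      then have id: "u * (cnj u * ?x + cnj v * ?y) + - cnj v * (- v * ?x + u * ?y) = ?x"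
        "v * (cnj u * ?x + cnj v * ?y) + cnj u * (- v * ?x + u * ?y) = ?y"
        by (simp_all only: n mult_1)
      have 1: "cis (\<chi> (z(n := b))) = 1" for b
        using False by (simp only: \<chi>_def ctrl of_bool_eq mult_zero_right cis_zero)
      moreover have "cis (\<chi> z) = 1" using 1[of "z n"] by simp
      ultimately have "gate_act (Single n V) (\<lambda>z. cis (\<chi> z) * gate_act (Single n W) \<psi> z) z = \<psi> z"
        using id by (cases "z n") (simp_all add: V_def W_def fun_upd_idem)
      then show ?thesis using False by (simp only: capply_def if_False)
    qed
  qed
  have diff: "cmod (cis (\<chi>' z) - cis (\<chi> z)) \<le> \<epsilon>" for z
  proof -
    \<comment> \<open>The omitted phase: the only discrepancy between the exact phase
      \<open>\<chi>\<close> and the phase \<open>\<chi>'\<close> of the core.\<close>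
    define \<delta> where "\<delta> = g z * of_bool (\<forall>q\<in>{m..<n}. z q) / 2 ^ m"
    have "(\<forall>q\<in>{..<n}. z q) \<longleftrightarrow> (\<forall>q\<in>{m..<n}. z q) \<and> (\<forall>q<m. z q)"
    proof safe
      fix q assume *: "\<forall>q\<in>{m..<n}. z q" "\<forall>q<m. z q" "q < n"
      then show "z q" by (cases "q < m") auto
    qed (use mn in auto)
    then have "\<chi>' z = \<chi> z + - \<delta>"
      by (simp add: \<chi>_def \<chi>'_def \<delta>_def of_bool_conj algebra_simps)
    then have "cis (\<chi>' z) - cis (\<chi> z) = cis (\<chi> z) * (cis (- \<delta>) - 1)"
      by (simp only: cis_mult[symmetric] right_diff_distrib mult_1_right)
    moreover have "\<bar>- \<delta>\<bar> \<le> arccos (1 - \<epsilon>\<^sup>2 / 2)"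
    proof -
      have "\<bar>\<delta>\<bar> \<le> \<bar>g z\<bar> / 2 ^ m"
        by (simp add: \<delta>_def abs_mult)
      also have "\<dots> \<le> arccos (1 - \<epsilon>\<^sup>2 / 2)"
        using \<alpha> \<beta> by (simp add: g_def)
      finally show ?thesis by simp
    qed
    ultimately show ?thesis
      using cmod_cis_minus_one_le[OF _ \<epsilon>] by (simp add: norm_mult)
  qed
  have norm_V: "euclid_norm (amp_vec (n + 1) (gate_act (Single n V) \<psi>)) = euclid_norm (amp_vec (n + 1) \<psi>)"
    and norm_W: "euclid_norm (amp_vec (n + 1) (gate_act (Single n W) \<psi>)) = euclid_norm (amp_vec (n + 1) \<psi>)" for \<psi>
  proof -
    have "of_real ((cmod u)\<^sup>2 + (cmod v)\<^sup>2) = (1 :: complex)"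
      using n unfolding of_real_add complex_norm_square by (simp add: mult.commute)
    then have nr: "(cmod u)\<^sup>2 + (cmod v)\<^sup>2 = 1"
      by (simp only: of_real_eq_1_iff)
    show "euclid_norm (amp_vec (n + 1) (gate_act (Single n V) \<psi>)) = euclid_norm (amp_vec (n + 1) \<psi>)"
      by (rule euclid_norm_Single) (use nr in \<open>simp_all add: V_def algebra_simps\<close>)
    show "euclid_norm (amp_vec (n + 1) (gate_act (Single n W) \<psi>)) = euclid_norm (amp_vec (n + 1) \<psi>)"
      by (rule euclid_norm_Single) (use nr in \<open>simp_all add: W_def algebra_simps\<close>)
  qed
  have CnU: "CnU n U \<in> carrier_mat (2 ^ (n + 1)) (2 ^ (n + 1))"
    unfolding CnU_def by (rule controlled_mat_carrier)
  show "spectral_norm (circuit_mat (n + 1) circ - CnU n U) \<le> \<epsilon>"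
  proof (rule spectral_norm_leI)
    show "circuit_mat (n + 1) circ - CnU n U \<in> carrier_mat (2 ^ (n + 1)) (2 ^ (n + 1))"
      using CnU by (rule minus_carrier_mat)
    fix \<psi>
    let ?w = "gate_act (Single n W) \<psi>"
    have "(circuit_mat (n + 1) circ - CnU n U) *\<^sub>v amp_vec (n + 1) \<psi>
      = amp_vec (n + 1) (act circ \<psi>) - amp_vec (n + 1) (capply {..<n} n U \<psi>)"
      unfolding minus_mult_distrib_mat_vec[OF circuit_mat_carrier CnU amp_vec_carrier]
        circuit_mat_mult_amp_vec[OF valid]
      unfolding CnU_def by (simp add: controlled_mat_mult_amp_vec)
    also have "\<dots> = amp_vec (n + 1) (gate_act (Single n V) (\<lambda>z. (cis (\<chi>' z) - cis (\<chi> z)) * ?w z))"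
      unfolding circ_act CnU_act gate_act.simps
      by (rule eq_vecI) (simp_all add: amp_vec_def algebra_simps)
    finally have "euclid_norm ((circuit_mat (n + 1) circ - CnU n U) *\<^sub>v amp_vec (n + 1) \<psi>)
      = euclid_norm (amp_vec (n + 1) (\<lambda>z. (cis (\<chi>' z) - cis (\<chi> z)) * ?w z))"
      by (simp only: norm_V)
    also have "\<dots> \<le> \<epsilon> * euclid_norm (amp_vec (n + 1) ?w)"
      by (rule euclid_norm_diag_le) (rule diff)
    finally show "euclid_norm ((circuit_mat (n + 1) circ - CnU n U) *\<^sub>v amp_vec (n + 1) \<psi>)
      \<le> \<epsilon> * euclid_norm (amp_vec (n + 1) \<psi>)"
      by (simp only: norm_W)
  qed
qed

lemma log_depth_core: "(\<lambda>n. real (depth (Single n W # core m n \<alpha> \<beta> @ [Single n V]))) \<in> O(\<lambda>n. log 2 (real n))"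
proof -
  \<comment> \<open>The depth independent of \<open>n\<close>: with exponent \<open>k + 1\<close>,
    \<open>depth_core\<close> adds 2 * 352, and the two outer gates add 2.\<close>
  define C where "C = 2 * (m * 64 + m * 256 + m * (2 + 32 * m + 256)) + 706"
  have "real (depth (Single n W # core m n \<alpha> \<beta> @ [Single n V])) \<le> (352 + real C) * log 2 (real n)"
    if n: "n \<ge> m + 3" for n
  proof -
    obtain k where k: "2 ^ k \<le> n" "n < 2 ^ (k + 1)"
      using ex_power_ivl1[of 2 n] n by auto
    let ?c = "core m n \<alpha> \<beta>"
    have "depth (Single n W # ?c @ [Single n V]) \<le> 1 + (depth ?c + 1)"
      using depth_append[of "[Single n W]" "?c @ [Single n V]"] depth_append[of ?c "[Single n V]"]
        depth_le_length[of "[Single n W]"] depth_le_length[of "[Single n V]"] by simp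
    also have "\<dots> \<le> 352 * k + C"
      using depth_core[OF n k(2), of \<alpha> \<beta>] by (simp add: C_def)
    finally have "real (depth (Single n W # ?c @ [Single n V])) \<le> real (352 * k + C)"
      by (rule of_nat_mono)
    also have "\<dots> \<le> 352 * log 2 (real n) + real C * log 2 (real n)"
    proof -
      have "1 \<le> log 2 (real n)" using n le_log2_of_power[of 1 n] by simp
      then have "real C * 1 \<le> real C * log 2 (real n)" by (intro mult_left_mono) auto
      moreover have "real k \<le> log 2 (real n)" by (rule le_log2_of_power[OF k(1)])
      ultimately show ?thesis by simp
    qed
    finally show ?thesis by (simp add: algebra_simps)
  qed
  then show ?thesis
    by (intro bigoI[where c = "352 + real C"] eventually_mono[OF eventually_ge_at_top[of "m + 3"]])
      (auto intro: order_trans[OF _ mult_left_mono[OF abs_ge_self]])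
qed

theorem theorem4:
  fixes U :: "complex mat"
  assumes "unitary_mat 2 U"
  shows "\<exists>\<theta>::real. \<forall>(\<epsilon>::real) (n\<^sub>b::nat).
    0 < \<epsilon> \<and> \<epsilon> \<le> 2 \<and> 1 \<le> n\<^sub>b \<and>
    (\<theta> = 0 \<or> real n\<^sub>b \<ge> log 2 (\<bar>\<theta>\<bar> / arccos (1 - \<epsilon>\<^sup>2 / 2))) \<longrightarrow>
    (\<exists>circ :: nat \<Rightarrow> circuit.
       (\<forall>n\<ge>n\<^sub>b + 5.
          valid_circuit (n + 1) (circ n) \<and>
          spectral_norm (circuit_mat (n + 1) (circ n) - CnU n U) \<le> \<epsilon> \<and>
          int (cnot_count (circ n)) \<le> 4 * (int n\<^sub>b - 1)\<^sup>2 + 24 * int n - 8 * int n\<^sub>b - 20) \<and>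
       (\<lambda>n. real (depth (circ n))) \<in> O(\<lambda>n. log 2 (real n)))"
proof (intro exI[of _ "2 ^ 8 * pi"] allI impI)
  fix \<epsilon> :: real and n\<^sub>b :: nat
  assume *: "0 < \<epsilon> \<and> \<epsilon> \<le> 2 \<and> 1 \<le> n\<^sub>b \<and>
    (2 ^ 8 * pi = 0 \<or> real n\<^sub>b \<ge> log 2 (\<bar>2 ^ 8 * pi\<bar> / arccos (1 - \<epsilon>\<^sup>2 / 2)))"
  define t where "t = arccos (1 - \<epsilon>\<^sup>2 / 2)"
  have \<epsilon>: "0 < \<epsilon>" "\<epsilon> \<le> 2" using * by auto
  have "\<epsilon>\<^sup>2 \<le> 2\<^sup>2" using \<epsilon> by (intro power_mono) auto
  then have b: "- 1 \<le> 1 - \<epsilon>\<^sup>2 / 2" "1 - \<epsilon>\<^sup>2 / 2 < 1" using \<epsilon> by auto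
  have t: "0 < t" "t \<le> pi"
    using arccos_less_arccos[OF b] arccos_ubound[OF b(1)] b by (auto simp: t_def)
  have "log 2 (2 ^ 8 * pi / t) \<le> real n\<^sub>b"
    using * by (simp add: t_def abs_mult)
  then have "2 ^ 8 * pi / t \<le> 2 powr real n\<^sub>b"
    using t(1) by (subst (asm) log_le_iff) auto
  then have pow: "2 ^ 8 * pi \<le> 2 ^ n\<^sub>b * t"
    using t(1) by (simp add: powr_realpow pos_divide_le_eq)
  also have "\<dots> \<le> 2 ^ n\<^sub>b * pi" using t(2) by simp
  \<comment> \<open>The angle \<open>t\<close> is at most pi, so the factor \<open>2 ^ 8\<close> in
    the chosen constant forces at least eight base controls.\<close>
  finally have "(2 :: real) ^ 8 \<le> 2 ^ n\<^sub>b" by simp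
  then have "8 \<le> n\<^sub>b" by (rule power_le_imp_le_exp[rotated]) simp
  then obtain m where m: "n\<^sub>b = m + 8" using le_Suc_ex add.commute by metis
  have pim: "pi / 2 ^ m \<le> t"
    using pow by (simp add: m power_add field_simps)
  obtain u v \<alpha> \<beta> where uv: "cnj u * u + cnj v * v = 1" and ab: "\<bar>\<alpha>\<bar> \<le> pi" "\<bar>\<beta>\<bar> \<le> pi"
    and U: "U = mat2 (cis \<alpha> * (u * cnj u) + cis \<beta> * (v * cnj v)) (cis \<alpha> * (u * cnj v) - cis \<beta> * (cnj v * u))
       (cis \<alpha> * (v * cnj u) - cis \<beta> * (cnj u * v)) (cis \<alpha> * (v * cnj v) + cis \<beta> * (u * cnj u))"
    using unitary_mat2_diagonalize[OF assms] by blast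
  have "\<bar>\<alpha>\<bar> / 2 ^ m \<le> pi / 2 ^ m" "\<bar>\<beta>\<bar> / 2 ^ m \<le> pi / 2 ^ m"
    using ab by (auto intro: divide_right_mono)
  then have ab': "\<bar>\<alpha>\<bar> / 2 ^ m \<le> arccos (1 - \<epsilon>\<^sup>2 / 2)" "\<bar>\<beta>\<bar> / 2 ^ m \<le> arccos (1 - \<epsilon>\<^sup>2 / 2)"
    using pim unfolding t_def by linarith+
  define circ where "circ = (\<lambda>n. Single n (mat2 (cnj u) (cnj v) (- v) u) # core m n \<alpha> \<beta> @
      [Single n (mat2 u (- cnj v) v (cnj u))])"
  show "\<exists>circ :: nat \<Rightarrow> circuit.
       (\<forall>n\<ge>n\<^sub>b + 5.
          valid_circuit (n + 1) (circ n) \<and>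
          spectral_norm (circuit_mat (n + 1) (circ n) - CnU n U) \<le> \<epsilon> \<and>
          int (cnot_count (circ n)) \<le> 4 * (int n\<^sub>b - 1)\<^sup>2 + 24 * int n - 8 * int n\<^sub>b - 20) \<and>
       (\<lambda>n. real (depth (circ n))) \<in> O(\<lambda>n. log 2 (real n))"
  proof (intro exI[of _ circ] conjI allI impI)
    fix n assume "n \<ge> n\<^sub>b + 5"
    then have mn: "m + 3 \<le> n" and n: "int m + 13 \<le> int n" by (auto simp: m)
    note approx = spectral_norm_core_le[OF uv U mn \<epsilon> ab' refl]
    show "valid_circuit (n + 1) (circ n)"
      unfolding circ_def by (rule approx(1))
    show "spectral_norm (circuit_mat (n + 1) (circ n) - CnU n U) \<le> \<epsilon>"
      unfolding circ_def by (rule approx(2))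
    have "3 * int (cnot_count (circ n)) \<le> 12 * int m * int m + 204 * int m + 64 * (int n - int m - 3)"
      using cnot_count_core[OF mn, of \<alpha> \<beta>] by (simp add: circ_def)
    \<comment> \<open>With \<open>n\<^sub>b = m + 8\<close>, three times the target is 12 m^2 + 144
      m + 72 n + 336, and three times the count is at most 12 m^2 + 140 m + 64 n - 192.\<close>
    then show "int (cnot_count (circ n)) \<le> 4 * (int n\<^sub>b - 1)\<^sup>2 + 24 * int n - 8 * int n\<^sub>b - 20"
      using n by (simp add: m power2_eq_square algebra_simps)
  next
    show "(\<lambda>n. real (depth (circ n))) \<in> O(\<lambda>n. log 2 (real n))"
      unfolding circ_def by (rule log_depth_core)
  qed
qed

end
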